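(* Every $2$-degenerate subcubic graph $G$ has a feasible coloring. In particular, $D(G)$ has a packing $7$-coloring.
   Context: Graphs are finite and simple. A graph is subcubic if its maximum degree is at most $3$. A graph is $k$-degenerate if every subgraph of it has a vertex of degree (in that subgraph) at most $k$. A feasible coloring of a graph $G$ is a coloring of $V(G)$ with (some of) the six colors $1_a,1_b,2_a,2_b,3_a,3_b$ such that, for all $i\in\{1,2,3\}$ and $x\in\{a,b\}$, the distance in $G$ between any two distinct vertices of color $i_x$ is at least $i+1$ (vertices in different components are at infinite distance). For a graph $G$, $D(G)$ denotes the graph obtained from $G$ by subdividing every edge once. A packing $k$-coloring of a graph $H$ is a partition of $V(H)$ into sets $V_1,\ldots,V_k$ (some possibly empty) such that for each $1\le i\le k$ the distance in $H$ between any two distinct vertices of $V_i$ is at least $i+1$. *)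

theory Defs
  imports
    "Graph_Theory.Pair_Digraph"
    "Graph_Theory.Digraph_Component"
    "Graph_Theory.Shortest_Path"
begin

text \<open>
  A finite simple graph is a symmetric, loop-free, finite digraph without parallel arcs, that is, a
  \<^locale>\<open>pair_graph\<close>: the undirected edge \<open>uv\<close> is the pair of arcs \<open>(u, v)\<close>, \<open>(v, u)\<close>.  The degree
  of a vertex is therefore its \<^const>\<open>out_degree\<close> (which equals its \<^const>\<open>in_degree\<close>).
\<close>

definition subcubic :: "'a pair_pre_digraph \<Rightarrow> bool" where
  "subcubic G \<longleftrightarrow> (\<forall>v\<in>pverts G. out_degree (with_proj G) v \<le> 3)"

text \<open>
  The condition \<^term>\<open>pair_graph H\<close> restricts to subgraphs in the undirected sense, as
  \<^const>\<open>subgraph\<close> also allows dropping only one of the two arcs of an edge.  The null subgraph,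
  which has no vertex at all, is excluded.
\<close>

definition degenerate :: "nat \<Rightarrow> 'a pair_pre_digraph \<Rightarrow> bool" where
  "degenerate k G \<longleftrightarrow>
     (\<forall>H. pair_graph H \<and> subgraph (with_proj H) (with_proj G) \<and> pverts H \<noteq> {}
        \<longrightarrow> (\<exists>v\<in>pverts H. out_degree (with_proj H) v \<le> k))"

text \<open>
  With unit weights the cost of a walk is its length.  The distance is \<open>\<infinity>\<close> between vertices of
  different components.
\<close>

definition graph_dist :: "'a pair_pre_digraph \<Rightarrow> 'a \<Rightarrow> 'a \<Rightarrow> ereal" where
  "graph_dist G u v = wf_digraph.\<mu> (with_proj G) (\<lambda>_. 1) u v"

datatype color = C1a | C1b | C2a | C2b | C3a | C3b

fun color_index :: "color \<Rightarrow> nat" where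
  "color_index C1a = 1"
| "color_index C1b = 1"
| "color_index C2a = 2"
| "color_index C2b = 2"
| "color_index C3a = 3"
| "color_index C3b = 3"

definition feasible_coloring :: "'a pair_pre_digraph \<Rightarrow> ('a \<Rightarrow> color) \<Rightarrow> bool" where
  "feasible_coloring G c \<longleftrightarrow>
     (\<forall>u\<in>pverts G. \<forall>v\<in>pverts G. u \<noteq> v \<and> c u = c v
        \<longrightarrow> graph_dist G u v \<ge> ereal (real (color_index (c u) + 1)))"

text \<open>
  Subdividing every edge once: \<open>Inl v\<close> is the original vertex \<open>v\<close>, and \<open>Inr {u, v}\<close> is the new
  vertex on the edge \<open>uv\<close>.
\<close>

definition subdivide_all :: "'a pair_pre_digraph \<Rightarrow> ('a + 'a set) pair_pre_digraph" where
  "subdivide_all G =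
     \<lparr> pverts = Inl ` pverts G \<union> {Inr {u, v} | u v. (u, v) \<in> parcs G},
       parcs = {(Inl u, Inr {u, v}) | u v. (u, v) \<in> parcs G}
             \<union> {(Inr {u, v}, Inl u) | u v. (u, v) \<in> parcs G} \<rparr>"

text \<open>The classes are \<open>V 1, \<dots>, V k\<close>; they may be empty, and other values of \<open>V\<close> are irrelevant.\<close>

definition packing_coloring :: "'a pair_pre_digraph \<Rightarrow> nat \<Rightarrow> (nat \<Rightarrow> 'a set) \<Rightarrow> bool" where
  "packing_coloring H k V \<longleftrightarrow>
     (\<Union>i\<in>{1..k}. V i) = pverts H \<and>
     (\<forall>i\<in>{1..k}. \<forall>j\<in>{1..k}. i \<noteq> j \<longrightarrow> V i \<inter> V j = {}) \<and>
     (\<forall>i\<in>{1..k}. \<forall>u\<in>V i. \<forall>v\<in>V i. u \<noteq> v \<longrightarrow> graph_dist H u v \<ge> ereal (real (i + 1)))"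

lemma pair_graph_subdivide_all:
  assumes "pair_graph G"
  shows "pair_graph (subdivide_all G)"
proof -
  interpret pair_graph G by fact
  have fin: "finite {f u v | u v. (u, v) \<in> parcs G}" for f :: "'a \<Rightarrow> 'a \<Rightarrow> 'c"
  proof -
    have "{f u v | u v. (u, v) \<in> parcs G} = (\<lambda>(u, v). f u v) ` parcs G" by force
    then show ?thesis using pair_finite_arcs by simp
  qed
  show ?thesis
  proof
    fix e assume "e \<in> parcs (subdivide_all G)"
    then show "fst e \<in> pverts (subdivide_all G)" "snd e \<in> pverts (subdivide_all G)"
      "fst e \<noteq> snd e"
      by (auto simp: subdivide_all_def dest: in_arcsD1)
  next
    show "finite (pverts (subdivide_all G))" "finite (parcs (subdivide_all G))"
      using pair_finite_verts by (auto simp: subdivide_all_def intro!: fin)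
  next
    show "symmetric (with_proj (subdivide_all G))"
      by (auto simp: symmetric_def subdivide_all_def intro!: symI)
  qed
qed

end

theory Submission
  imports Defs
begin

text \<open>
  Delete the vertex \<open>v\<close> of degree at most 2 and colour the rest inductively.  What makes this work is
  to strengthen the claim: the root \<open>v\<close> gets a colour of index 1 or 2, and at most one neighbour of
  \<open>v\<close> has index 3.  The next root is a neighbour \<open>u\<close> of \<open>v\<close>; let \<open>u'\<close> be the other neighbour.  Among
  the good colourings of \<open>G - v\<close> take one with the fewest vertices of index 3 and, among those, the
  fewest of index 2, so that every vertex of index 2 or 3 sees both colours of index 1.  Putting \<open>v\<close>
  back, only three cases are not immediate.

  If \<open>u\<close> has index 1 and \<open>u'\<close> has index 3, minimality shows that no other vertex of index 3 lies
  within distance 3 of \<open>u'\<close> in \<open>G - v\<close>, so the colour of \<open>u'\<close> can be swapped for the other one of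
  index 3.  If \<open>u\<close> and \<open>u'\<close> share a colour of index 2, either \<open>u\<close> can be recoloured with index at
  most 2, or at most one colour of index 3 occurs within distance 3 of \<open>u\<close> and the other one is
  available.  If \<open>u\<close> and \<open>u'\<close> have the two different colours of index 1, the failure of a list of
  local recolourings pins down the colours around \<open>u\<close> until another recolouring succeeds.

  Each local recolouring erases a few vertices and colours them again one at a time; its failure
  exhibits a vertex of the offending colour nearby.
\<close>

section \<open>Partial colourings and recolouring\<close>

lemma color_index_cases: "color_index c = 1 \<or> color_index c = 2 \<or> color_index c = 3"
  by (cases c) auto

lemma color_index_two_values:
  assumes "color_index c = color_index p" "color_index q = color_index p" "p \<noteq> q"
  shows "c = p \<or> c = q"
  using assms by (cases c; cases p; cases q) auto

lemma other_color:
  obtains d where "color_index d = color_index c" "d \<noteq> c"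
  by (cases c) (auto intro: that[of C1a] that[of C1b] that[of C2a] that[of C2b] that[of C3a] that[of C3b])

definition high :: "('a \<Rightarrow> color option) \<Rightarrow> 'a set" where
  "high g = {x. \<exists>c. g x = Some c \<and> color_index c = 3}"

text \<open>All vertices of a list of moves are blanked before the first is coloured again, so their
  old colours cannot obstruct the new ones.\<close>

primrec erase :: "('a \<times> color) list \<Rightarrow> ('a \<Rightarrow> color option) \<Rightarrow> 'a \<Rightarrow> color option" where
  "erase [] g = g"
| "erase (m # ms) g = (erase ms g)(fst m := None)"

primrec recolor :: "('a \<times> color) list \<Rightarrow> ('a \<Rightarrow> color option) \<Rightarrow> 'a \<Rightarrow> color option" where
  "recolor [] g = g"
| "recolor (m # ms) g = recolor ms (g(fst m := Some (snd m)))"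

abbreviation move :: "('a \<times> color) list \<Rightarrow> ('a \<Rightarrow> color option) \<Rightarrow> 'a \<Rightarrow> color option" where
  "move ms g \<equiv> recolor ms (erase ms g)"

lemma recolor_notin: "x \<notin> fst ` set ms \<Longrightarrow> recolor ms g x = g x"
  by (induction ms arbitrary: g) auto

lemma erase_notin: "x \<notin> fst ` set ms \<Longrightarrow> erase ms g x = g x"
  by (induction ms) auto

lemma recolor_in: "x \<in> fst ` set ms \<Longrightarrow> \<exists>c\<in>snd ` set ms. recolor ms g x = Some c"
proof (induction ms arbitrary: g)
  case (Cons m ms)
  then show ?case
    by (cases "x \<in> fst ` set ms") (auto simp: recolor_notin)
qed simp

lemma move_neq_None: "g x \<noteq> None \<Longrightarrow> move ms g x \<noteq> None"
  using recolor_in[of x ms "erase ms g"]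
  by (cases "x \<in> fst ` set ms") (auto simp: recolor_notin erase_notin)

section \<open>Distance conditions expressed through neighbourhoods\<close>

locale subcubic_nbhd =
  fixes V :: "'a set" and N :: "'a \<Rightarrow> 'a set"
  assumes finite_V: "finite V"
    and N_V: "y \<in> N x \<Longrightarrow> y \<in> V"
    and N_sym: "y \<in> N x \<Longrightarrow> x \<in> N y"
    and N_irrefl: "x \<notin> N x"
    and card_N: "card (N x) \<le> 3"
begin

text \<open>
  The guards \<open>z \<noteq> x\<close> and \<open>t \<noteq> x\<close> keep the present colour of \<open>x\<close> irrelevant; no walk is lost by
  them, as one that returns to \<open>x\<close> is covered by a shorter one.
\<close>

definition free :: "('a \<Rightarrow> color option) \<Rightarrow> 'a \<Rightarrow> color \<Rightarrow> bool" where
  "free g x c \<longleftrightarrow>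
     (\<forall>y\<in>N x. g y \<noteq> Some c \<and>
       (2 \<le> color_index c \<longrightarrow> (\<forall>z\<in>N y. z \<noteq> x \<longrightarrow> g z \<noteq> Some c \<and>
         (3 \<le> color_index c \<longrightarrow> (\<forall>t\<in>N z. t \<noteq> x \<longrightarrow> g t \<noteq> Some c)))))"

text \<open>Blank vertices still carry walks, so the distances are those of the whole graph. Colours
  outside \<open>V\<close> are unconstrained, because \<open>N_V\<close> and \<open>N_sym\<close>
  force \<open>N x = {}\<close> there.\<close>

definition valid :: "('a \<Rightarrow> color option) \<Rightarrow> bool" where
  "valid g \<longleftrightarrow> (\<forall>x c. g x = Some c \<longrightarrow> free g x c)"

lemma free1: "color_index c = Suc 0 \<Longrightarrow> free g x c \<longleftrightarrow> (\<forall>y\<in>N x. g y \<noteq> Some c)"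
  by (auto simp: free_def)

lemma free2: "color_index c = 2 \<Longrightarrow> free g x c \<longleftrightarrow>
    (\<forall>y\<in>N x. g y \<noteq> Some c \<and> (\<forall>z\<in>N y. z \<noteq> x \<longrightarrow> g z \<noteq> Some c))"
  by (auto simp: free_def)

lemma free3: "color_index c = 3 \<Longrightarrow> free g x c \<longleftrightarrow>
    (\<forall>y\<in>N x. g y \<noteq> Some c \<and> (\<forall>z\<in>N y. z \<noteq> x \<longrightarrow> g z \<noteq> Some c \<and>
      (\<forall>t\<in>N z. t \<noteq> x \<longrightarrow> g t \<noteq> Some c)))"
  by (auto simp: free_def)

lemma finite_N: "finite (N x)"
  using finite_V N_V by (meson finite_subset subsetI)

lemma free_mono:
  assumes "free g x c" "\<And>y. h y = Some c \<Longrightarrow> g y = Some c"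
  shows "free h x c"
  using assms unfolding free_def by blast

lemma valid_erase:
  assumes "valid g"
  shows "valid (g(x := None))"
  unfolding valid_def
proof (intro allI impI)
  fix y c assume "(g(x := None)) y = Some c"
  then have "free g y c" using assms by (simp add: valid_def split: if_splits)
  then show "free (g(x := None)) y c" by (rule free_mono) (simp split: if_splits)
qed

text \<open>A walk of at most three steps from another vertex \<open>y\<close> of colour
  \<open>c\<close> to \<open>x\<close>, read backwards, would violate \<open>free g x c\<close>. The
  facts \<open>1\<close>, \<open>2\<close>, \<open>3\<close> treat the three lengths.\<close>

lemma valid_set:
  assumes g: "valid g" and x: "free g x c"
  shows "valid (g(x := Some c))"
  unfolding valid_def
proof (intro allI impI)
  fix y d assume y: "(g(x := Some c)) y = Some d"
  show "free (g(x := Some c)) y d"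
  proof (cases "y = x")
    case True
    then show ?thesis using x y N_irrefl by (auto simp: free_def)
  next
    case False
    then have d: "g y = Some d" using y by simp
    then have fy: "free g y d" using g by (auto simp: valid_def)
    show ?thesis
    proof (cases "d = c")
      case True
      have 1: "x \<notin> N y"
      proof
        assume "x \<in> N y"
        then have "y \<in> N x" by (rule N_sym)
        then show False using x d True by (simp add: free_def)
      qed
      have 2: "x \<notin> N z" if z: "z \<in> N y" "2 \<le> color_index c" for z
      proof
        assume "x \<in> N z"
        then have "z \<in> N x" "y \<in> N z" using z N_sym by blast+
        then show False using x d True z False by (simp add: free_def)
      qed
      have 3: "x \<notin> N t" if "z \<in> N y" "t \<in> N z" "t \<noteq> y" "3 \<le> color_index c" for z t
      proof
        assume xt: "x \<in> N t"
        have "z \<noteq> x" using 1 that by auto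
        moreover have "t \<in> N x" "z \<in> N t" "y \<in> N z" using that xt N_sym by blast+
        moreover have "2 \<le> color_index c" using that by simp
        ultimately show False using x d True that False by (simp add: free_def)
      qed
      show ?thesis
        unfolding free_def
      proof (intro ballI conjI impI)
        fix z assume z: "z \<in> N y"
        show "(g(x := Some c)) z \<noteq> Some d" using z 1 fy by (auto simp: free_def)
        assume i: "2 \<le> color_index d"
        fix t assume t: "t \<in> N z" "t \<noteq> y"
        show "(g(x := Some c)) t \<noteq> Some d" using z t i 2[OF z] True fy by (auto simp: free_def)
        assume i: "3 \<le> color_index d"
        fix s assume s: "s \<in> N t" "s \<noteq> y"
        show "(g(x := Some c)) s \<noteq> Some d" using z t i s 3[OF z t] True fy by (auto simp: free_def)
      qed
    next
      case False
      then show ?thesis using fy by (simp add: free_def)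
    qed
  qed
qed

lemma valid_neq: "valid g \<Longrightarrow> g x = Some c \<Longrightarrow> y \<in> N x \<Longrightarrow> g y \<noteq> Some c"
  unfolding valid_def free_def by blast

lemma valid_neq2: "valid g \<Longrightarrow> g x = Some c \<Longrightarrow> 2 \<le> color_index c \<Longrightarrow> y \<in> N x \<Longrightarrow> z \<in> N y \<Longrightarrow> z \<noteq> x
    \<Longrightarrow> g z \<noteq> Some c"
  unfolding valid_def free_def by blast

text \<open>Each colour must be free at the moment it is placed, with the earlier moves made and the
  later vertices still blank.\<close>

primrec playable :: "('a \<times> color) list \<Rightarrow> ('a \<Rightarrow> color option) \<Rightarrow> bool" where
  "playable [] g \<longleftrightarrow> True"
| "playable (m # ms) g \<longleftrightarrow> free g (fst m) (snd m) \<and> playable ms (g(fst m := Some (snd m)))"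

lemma valid_move:
  assumes "valid g" "playable ms (erase ms g)"
  shows "valid (move ms g)"
proof -
  have "valid (erase ms g)" using assms(1) by (induction ms) (auto intro: valid_erase)
  moreover have "valid h \<Longrightarrow> playable ms h \<Longrightarrow> valid (recolor ms h)" for h
    by (induction ms arbitrary: h) (simp_all add: valid_set)
  ultimately show ?thesis using assms(2) by blast
qed

text \<open>In the inductive step the root is a neighbour of the deleted vertex; the last clause
  then ensures that some colour of index 3 is absent from its neighbours.\<close>

definition good :: "('a \<Rightarrow> color option) \<Rightarrow> 'a \<Rightarrow> bool" where
  "good g x \<longleftrightarrow> valid g \<and> (\<forall>y\<in>V. g y \<noteq> None) \<and> x \<notin> high g \<and>
     (\<forall>y\<in>N x \<inter> high g. \<forall>z\<in>N x \<inter> high g. y = z)"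

text \<open>
  Vertices of degree less than 3 are handled by listing a neighbour repeatedly, so the names in
  \<open>N y = {x, z, t}\<close> need not be distinct.
\<close>

lemma nbhd3:
  assumes "a \<in> N x" "b \<in> N x" "a \<noteq> b"
  obtains c where "N x = {a, b, c}" "c \<noteq> a"
proof -
  have f: "finite (N x - {a, b})" using finite_N by simp
  have c: "card (N x - {a, b}) \<le> Suc 0"
    using card_N[of x] assms by (simp add: card_Diff_subset)
  have *: "\<exists>d\<in>N x. N x - {a, b} \<subseteq> {d} \<and> d \<noteq> a"
  proof (cases "N x - {a, b} = {}")
    case True
    then show ?thesis using assms by blast
  next
    case False
    then obtain d where d: "d \<in> N x - {a, b}" by blast
    then have "\<forall>y\<in>N x - {a, b}. y = d"
      using c unfolding card_le_Suc0_iff_eq[OF f] by blast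
    then show ?thesis using d by (intro bexI[of _ d]) blast+
  qed
  then obtain d where d: "d \<in> N x" "N x - {a, b} \<subseteq> {d}" "d \<noteq> a" by blast
  then have "N x = {a, b, d}" using assms by blast
  then show ?thesis using d(3) by (rule that)
qed

lemma nbhd_any:
  assumes "x \<in> N y"
  obtains z t where "N y = {x, z, t}"
proof (cases "N y = {x}")
  case True
  then have "N y = {x, x, x}" by simp
  then show ?thesis by (rule that)
next
  case False
  then obtain z where "z \<in> N y" "x \<noteq> z" using assms by blast
  then show ?thesis using nbhd3[OF assms] that by metis
qed

lemma nbhd_expand:
  assumes "x \<in> N y" "\<exists>z\<in>N y. z \<noteq> x \<and> P z"
  obtains z t where "N y = {x, z, t}" "P z" "z \<noteq> x" "t \<noteq> x"
proof -
  obtain z where z: "z \<in> N y" "z \<noteq> x" "P z" using assms(2) by blast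
  obtain t where "N y = {x, z, t}" "t \<noteq> x" using nbhd3[OF assms(1) z(1)] z(2) by metis
  then show ?thesis using z that by blast
qed

text \<open>Turns a failed recolouring into a witness: assume that both remaining names in
  \<open>N y\<close> miss \<open>P\<close>, play moves that lead to a contradiction, and conclude
  that a neighbour other than \<open>x\<close> has \<open>P\<close>. The guards allow a name to
  repeat \<open>x\<close>.\<close>

lemma nbhd_pick:
  assumes x: "x \<in> N y"
    and n: "\<And>z t. N y = {x, z, t} \<Longrightarrow> (z \<noteq> x \<Longrightarrow> \<not> P z) \<Longrightarrow> (t \<noteq> x \<Longrightarrow> \<not> P t) \<Longrightarrow> False"
  obtains z t where "N y = {x, z, t}" "P z" "z \<noteq> x" "t \<noteq> x"
proof -
  have "\<exists>z\<in>N y. z \<noteq> x \<and> P z"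
  proof (rule ccontr)
    assume c: "\<not> ?thesis"
    obtain z t where t: "N y = {x, z, t}" using x by (rule nbhd_any)
    then show False by (rule n) (use c t in blast)+
  qed
  with x show ?thesis by (rule nbhd_expand) (rule that)
qed

end

section \<open>Two neighbours with different colours of index 1\<close>

text \<open>The vertices record why simple moves fail: \<open>a\<close> blocks \<open>q\<close> at
  \<open>u\<close>, \<open>a'\<close> blocks \<open>p\<close> at \<open>u'\<close>, and
  \<open>w\<close>, \<open>w'\<close> block the two colours of index 2 at \<open>v\<close>.
  \<open>nbr_color\<close> comes from minimality, and \<open>not_good\<close> is the assumption to
  be refuted.\<close>

locale stuck = subcubic_nbhd V N for V :: "'a set" and N +
  fixes f v u u' a w a' w' p q r s
  assumes valid_f: "valid f" and f_v: "f v = None"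
    and total: "\<And>x. x \<in> V \<Longrightarrow> x \<noteq> v \<Longrightarrow> f x \<noteq> None"
    and Nv: "N v = {u, u'}" and Nu: "N u = {v, a, w}" and Nu': "N u' = {v, a', w'}"
    and fu: "f u = Some p" and fu': "f u' = Some q"
    and fa: "f a = Some q" and fw: "f w = Some r"
    and fa': "f a' = Some p" and fw': "f w' = Some s"
    and idx: "color_index p = 1" "color_index q = 1" "color_index r = 2" "color_index s = 2"
    and pq: "p \<noteq> q" and rs: "r \<noteq> s"
    and nbr_color: "\<And>x c i. f x = Some c \<Longrightarrow> color_index c \<noteq> 1 \<Longrightarrow> color_index i = 1 \<Longrightarrow> \<exists>y\<in>N x. f y = Some i"
    and not_good: "\<And>g. \<not> good g v"
begin

lemma colors_neq: "p \<noteq> r" "p \<noteq> s" "q \<noteq> r" "q \<noteq> s" "r \<noteq> p" "s \<noteq> p" "r \<noteq> q" "s \<noteq> q" "q \<noteq> p" "s \<noteq> r"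
  using idx pq rs by auto

text \<open>Once \<open>p\<close> has left \<open>u\<close>, \<open>v\<close> can take it. Since
  \<open>u'\<close> still has index 1, \<open>u\<close> may even receive a colour of index
  3.\<close>

lemma complete_one:
  assumes m: "playable ms (erase ms f)" "v \<notin> fst ` set ms"
    and u: "move ms f u \<noteq> Some p" and u': "move ms f u' = Some q"
  shows False
proof -
  let ?g = "move ms f"
  have v: "?g v = None" using m(2) f_v by (simp add: recolor_notin erase_notin)
  have "valid ?g" using valid_f m(1) by (rule valid_move)
  moreover have "free ?g v p" using u u' idx pq by (simp add: free1 Nv)
  ultimately have "valid (?g(v := Some p))" by (rule valid_set)
  moreover have "?g y \<noteq> None" if "y \<in> V" "y \<noteq> v" for y
    using total[OF that] by (rule move_neq_None)
  moreover have "u' \<notin> high (?g(v := Some p))" using u' idx N_irrefl[of v] Nv by (auto simp: high_def)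
  moreover have "N v \<inter> high (?g(v := Some p)) \<subseteq> {u}" "v \<notin> high (?g(v := Some p))"
    using calculation(3) idx Nv by (auto simp: high_def)
  ultimately have "good (?g(v := Some p)) v" unfolding good_def by (simp; blast)
  then show False using not_good by blast
qed

text \<open>Apart from \<open>v\<close>, the six listed vertices are everything within distance 2 of
  \<open>v\<close>, so \<open>v\<close> can take \<open>r\<close>.\<close>

lemma complete_two:
  assumes m: "playable ms (erase ms f)" "v \<notin> fst ` set ms"
    and u: "\<forall>y\<in>{u, u', a, w, a', w'}. move ms f y \<noteq> Some r"
    and u': "move ms f u' \<in> {Some p, Some q}"
  shows False
proof -
  let ?g = "move ms f"
  have v: "?g v = None" using m(2) f_v by (simp add: recolor_notin erase_notin)
  have "valid ?g" using valid_f m(1) by (rule valid_move)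
  moreover have "free ?g v r" using u v idx by (simp add: free2 Nv Nu Nu')
  ultimately have "valid (?g(v := Some r))" by (rule valid_set)
  moreover have "?g y \<noteq> None" if "y \<in> V" "y \<noteq> v" for y
    using total[OF that] by (rule move_neq_None)
  moreover have "u' \<noteq> v" using N_irrefl[of v] Nv by auto
  then have "u' \<notin> high (?g(v := Some r))" using u' unfolding high_def by (elim insertE emptyE) (simp_all add: idx)
  moreover have "N v \<inter> high (?g(v := Some r)) \<subseteq> {u}" "v \<notin> high (?g(v := Some r))"
    using calculation(3) idx Nv by (auto simp: high_def)
  ultimately have "good (?g(v := Some r)) v" unfolding good_def by (simp; blast)
  then show False using not_good by blast
qed

lemma high_neq:
  assumes "color_index i = 3"
  shows "i \<noteq> p" "i \<noteq> q" "i \<noteq> r" "i \<noteq> s" "p \<noteq> i" "q \<noteq> i" "r \<noteq> i" "s \<noteq> i"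
  using assms idx by auto

lemma nbr_color':
  assumes "f x = Some c" "color_index c \<noteq> 1" "color_index i = 1" "f y \<noteq> Some i"
  shows "\<exists>z\<in>N x. z \<noteq> y \<and> f z = Some i"
  using nbr_color[OF assms(1-3)] assms(4) by metis

text \<open>
  As a conditional rewrite rule this lets the simplifier tell nodes apart by their colours.
\<close>

lemma neq_by_color: "f x \<noteq> f y \<Longrightarrow> x = y \<longleftrightarrow> False"
  by auto

text \<open>Exchanging \<open>u\<close> with \<open>u'\<close> also exchanges \<open>p\<close> with
  \<open>q\<close> and \<open>r\<close> with \<open>s\<close>; facts about the side of
  \<open>u\<close> thereby transfer to the side of \<open>u'\<close>.\<close>

lemma swapped: "stuck V N f v u' u a' w' a w q p s r"
proof -
  have "N v = {u', u}" using Nv by (simp add: insert_commute)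
  show ?thesis
    by (unfold_locales) (fact \<open>N v = {u', u}\<close> valid_f f_v total Nu Nu' fu fu' fa fw fa' fw' idx pq[symmetric] rs[symmetric]
        nbr_color not_good)+
qed

lemmas facts = fu fu' fa fw fa' fw' f_v colors_neq idx pq rs
lemmas frees = free1 free2 free3 Nv Nu Nu'

section \<open>The case of a triangle \<open>v\<close>, \<open>u\<close>, \<open>u'\<close>\<close>

lemma triangle_nodes:
  assumes "u' \<in> N u"
  shows "a = u'" "a' = u"
proof -
  have "u' \<in> {v, a, w}" using assms unfolding Nu .
  moreover have "u' \<noteq> v" "u' \<noteq> w" using fu' f_v fw idx by force+
  ultimately show "a = u'" by blast
  have "u \<in> {v, a', w'}" using N_sym[OF assms] unfolding Nu' .
  moreover have "u \<noteq> v" "u \<noteq> w'" using fu f_v fw' idx by force+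
  ultimately show "a' = u" by blast
qed

lemma triangle_distinct:
  assumes "u' \<in> N u"
  shows "u \<noteq> u'" "u \<noteq> w" "u' \<noteq> w" "v \<noteq> u" "v \<noteq> u'" "v \<noteq> w"
  using neq_by_color[of u u'] neq_by_color[of u w] neq_by_color[of u' w] neq_by_color[of v u] neq_by_color[of v u'] neq_by_color[of v w]
  by (simp_all add: facts)

lemma N_w_neq:
  assumes "u' \<in> N u" "x \<in> N w"
  shows "x \<noteq> u'" "u' \<noteq> x"
proof -
  have "w \<notin> N u'" using triangle_nodes[OF assms(1)] triangle_distinct[OF assms(1)] neq_by_color[of w w']
    by (simp add: Nu' facts eq_commute[of w])
  then show "x \<noteq> u'" "u' \<noteq> x" using N_sym[OF assms(2)] by blast+
qed

text \<open>Minimality supplies the neighbour of colour \<open>q\<close>. If the third neighbour did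
  not have colour \<open>p\<close>, then \<open>u\<close> and \<open>u'\<close> could exchange
  colours, \<open>w\<close> could take \<open>p\<close>, and \<open>r\<close> would be left for
  \<open>v\<close>.\<close>

lemma triangle_w:
  assumes "u' \<in> N u"
  obtains e c where "N w = {u, e, c}" "f e = Some q" "f c = Some p" "c \<noteq> u"
proof -
  have [simp]: "a = u'" "a' = u" using triangle_nodes[OF assms] by simp_all
  have "u \<in> N w" by (rule N_sym) (simp add: Nu)
  moreover have "\<exists>e\<in>N w. e \<noteq> u \<and> f e = Some q" by (rule nbr_color'[OF fw]) (use facts in simp_all)
  ultimately obtain e c where Nw: "N w = {u, e, c}" "f e = Some q" "c \<noteq> u" by (rule nbhd_expand)
  have [simp]: "e \<noteq> u'" "c \<noteq> u'" using N_w_neq[OF assms] Nw by simp_all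
  have "f c = Some p"
  proof (rule ccontr)
    assume n: "f c \<noteq> Some p"
    have "playable [(u, q), (u', p), (w, p)] (erase [(u, q), (u', p), (w, p)] f)"
      using triangle_distinct[OF assms] by (simp add: facts frees neq_by_color Nw n)
    then show False by (rule complete_two) (simp_all add: facts neq_by_color)
  qed
  with Nw that show ?thesis by blast
qed

text \<open>Pigeonhole: failed recolourings of \<open>w\<close> and \<open>u\<close> force
  \<open>s\<close> and both colours of index 3 onto the two vertices \<open>e1\<close> and
  \<open>c1\<close>.\<close>

lemma no_triangle: "u' \<notin> N u"
proof
  assume tri: "u' \<in> N u"
  have [simp]: "a = u'" "a' = u" using triangle_nodes[OF tri] by simp_all
  interpret sw: stuck V N f v u' u a' w' a w q p s r by (rule swapped)
  obtain e c where Nw: "N w = {u, e, c}" "f e = Some q" "f c = Some p" "c \<noteq> u"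
    by (rule triangle_w[OF tri])
  obtain g h where Nw': "N w' = {u', g, h}" "f g = Some p" "f h = Some q"
    by (rule sw.triangle_w[OF N_sym[OF tri]])
  have e: "e \<noteq> u'" "u' \<noteq> e" "c \<noteq> u'" "u' \<noteq> c" using N_w_neq[OF tri] Nw by simp_all
  note [simp] = facts frees neq_by_color Nw Nw' e Nw(4)[symmetric]
  obtain z e1 where Ne: "N e = {w, z, e1}" "f z = Some p"
  proof (rule nbhd_pick[of w e "\<lambda>z. f z = Some p"])
    show "w \<in> N e" by (rule N_sym) simp
  next
    fix z e1 assume n: "N e = {w, z, e1}" "z \<noteq> w \<Longrightarrow> f z \<noteq> Some p" "e1 \<noteq> w \<Longrightarrow> f e1 \<noteq> Some p"
    have "playable [(e, p), (w, q)] (erase [(e, p), (w, q)] f)"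
      by (simp add: n)
    then show False by (rule complete_two) simp_all
  qed (rule that)
  obtain y c1 where Nc: "N c = {w, y, c1}" "f y = Some q"
  proof (rule nbhd_pick[of w c "\<lambda>z. f z = Some q"])
    show "w \<in> N c" by (rule N_sym) simp
  next
    fix y c1 assume n: "N c = {w, y, c1}" "y \<noteq> w \<Longrightarrow> f y \<noteq> Some q" "c1 \<noteq> w \<Longrightarrow> f c1 \<noteq> Some q"
    \<comment> \<open>\<open>u\<close> takes colour \<open>q\<close> before \<open>c\<close> does,
      so it must not be a neighbour of \<open>c\<close>.\<close>
    have "u \<notin> N c" using N_sym[of u c] by (auto simp: Nu)
    then have "u \<noteq> y" "u \<noteq> c1" unfolding n(1) by auto
    then have "playable [(u', p), (u, q), (c, q), (w, p)] (erase [(u', p), (u, q), (c, q), (w, p)] f)"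
      by (simp add: n eq_commute[of _ u])
    then show False by (rule complete_two) simp_all
  qed (rule that)
  have s: "f e1 = Some s \<or> f c1 = Some s"
  proof (rule ccontr)
    assume "\<not> ?thesis"
    then have "playable [(w, s)] (erase [(w, s)] f)" by (simp add: Ne Nc)
    then show False by (rule complete_two) simp_all
  qed
  have "f e1 = Some i \<or> f c1 = Some i" if i: "color_index i = 3" for i
  proof (rule ccontr)
    assume "\<not> ?thesis"
    then have "playable [(u, i)] (erase [(u, i)] f)" by (simp add: Ne Nc i high_neq)
    then show False by (rule complete_one) (simp_all add: i high_neq)
  qed
  from s this[of C3a] this[of C3b] show False using high_neq[of C3a] high_neq[of C3b] by auto
qed

end

section \<open>The case of nonadjacent \<open>u\<close> and \<open>u'\<close>\<close>

locale stuck_path = stuck + assumes nonadj: "u' \<notin> N u"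
begin

lemma distinct_nodes: "a \<noteq> u'" "w \<noteq> u'" "a \<noteq> v" "w \<noteq> v" "u \<noteq> v" "u' \<noteq> v" "u' \<noteq> u" "a \<noteq> u" "w \<noteq> u" "w \<noteq> a"
  subgoal using nonadj Nu by auto
  subgoal using nonadj Nu by auto
  subgoal using fa f_v by force
  subgoal using fw f_v by force
  subgoal using fu f_v by force
  subgoal using fu' f_v by force
  subgoal using fu fu' pq by force
  subgoal using fu fa pq by force
  subgoal using fu fw idx by force
  subgoal using fa fw idx by force
  done

text \<open>\<open>e\<close> comes from minimality, and \<open>d\<close> from failing to recolour
  \<open>a\<close>, \<open>u\<close> with \<open>p\<close>, \<open>q\<close>. Failing to give
  \<open>s\<close> to \<open>u\<close>, or \<open>p\<close> to \<open>w\<close> and then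
  \<open>r\<close> to \<open>u\<close>, leaves only two patterns for \<open>c\<close> and
  \<open>b\<close>, which \<open>type_one\<close> and \<open>type_two\<close> refute.\<close>

lemma obtain_nodes:
  obtains e c d b where "N w = {u, e, c}" "f e = Some q" "c \<noteq> u"
    "N a = {u, d, b}" "f d = Some p" "d \<noteq> u" "b \<noteq> u"
    "f c = Some p \<and> f b = Some s \<or> f c = Some s \<and> f b = Some r"
proof -
  have "u \<in> N w" by (rule N_sym) (simp add: Nu)
  moreover have "\<exists>e\<in>N w. e \<noteq> u \<and> f e = Some q" by (rule nbr_color'[OF fw]) (use facts in simp_all)
  ultimately obtain e c where ec: "N w = {u, e, c}" "f e = Some q" "c \<noteq> u" by (rule nbhd_expand)
  have "u \<in> N a" by (rule N_sym) (simp add: Nu)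
  moreover have "\<exists>d\<in>N a. d \<noteq> u \<and> f d = Some p"
  proof (rule ccontr)
    assume "\<not> ?thesis"
    then have "playable [(a, p), (u, q)] (erase [(a, p), (u, q)] f)"
      using distinct_nodes facts by (auto simp: frees)
    then show False by (rule complete_one) (use facts distinct_nodes in auto)
  qed
  ultimately obtain d b where db: "N a = {u, d, b}" "f d = Some p" "d \<noteq> u" "b \<noteq> u"
    by (rule nbhd_expand)
  have "f c = Some s \<or> f b = Some s"
  proof (rule ccontr)
    assume "\<not> ?thesis"
    then have "playable [(u, s)] (erase [(u, s)] f)"
      using distinct_nodes facts ec db by (auto simp: frees)
    then show False by (rule complete_one) (use facts distinct_nodes in auto)
  qed
  moreover have "f c = Some p \<or> f b = Some r"
  proof (rule ccontr)
    assume n: "\<not> ?thesis"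
    have "f c \<noteq> Some r" by (rule valid_neq[OF valid_f fw]) (simp add: ec)
    then have "playable [(w, p), (u, r)] (erase [(w, p), (u, r)] f)"
      using n distinct_nodes facts ec db by (auto simp: frees)
    then show False by (rule complete_one) (use facts distinct_nodes in auto)
  qed
  ultimately have "f c = Some p \<and> f b = Some s \<or> f c = Some s \<and> f b = Some r"
    using colors_neq by auto
  with ec db that show ?thesis by blast
qed

end

locale stuck_nodes = stuck_path +
  fixes e c d b
  assumes Nw: "N w = {u, e, c}" and fe: "f e = Some q" and cu: "c \<noteq> u"
    and Na: "N a = {u, d, b}" and fd: "f d = Some p" and du: "d \<noteq> u" and bu: "b \<noteq> u"
begin

lemmas node_simps = facts frees neq_by_color distinct_nodes distinct_nodes[symmetric] Nw fe Na fd
  cu cu[symmetric] du du[symmetric] bu bu[symmetric]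

text \<open>Otherwise \<open>d\<close>, \<open>a\<close>, \<open>u\<close> could be recoloured
  \<open>q\<close>, \<open>p\<close>, \<open>q\<close>, and \<open>v\<close> could take
  \<open>p\<close>.\<close>

lemma obtain_d_nbrs:
  assumes b: "f b \<noteq> Some p" "f b \<noteq> Some q"
  obtains k d1 where "N d = {a, k, d1}" "f k = Some q" "k \<noteq> a" "d1 \<noteq> a"
proof (rule nbhd_pick[of a d "\<lambda>k. f k = Some q"])
  show "a \<in> N d" by (rule N_sym) (simp add: Na)
next
  fix k d1 assume n: "N d = {a, k, d1}" "k \<noteq> a \<Longrightarrow> f k \<noteq> Some q" "d1 \<noteq> a \<Longrightarrow> f d1 \<noteq> Some q"
  have "playable [(d, q), (a, p), (u, q)] (erase [(d, q), (a, p), (u, q)] f)"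
    by (simp add: node_simps b n)
  then show False by (rule complete_one) (simp_all add: node_simps)
qed (rule that)

text \<open>Otherwise \<open>e\<close> could take \<open>p\<close> and \<open>w\<close> could take
  \<open>q\<close>, which frees \<open>r\<close> for \<open>v\<close>.\<close>

lemma obtain_e_nbrs:
  assumes c: "f c \<noteq> Some q"
  obtains z e1 where "N e = {w, z, e1}" "f z = Some p" "z \<noteq> w" "e1 \<noteq> w"
proof (rule nbhd_pick[of w e "\<lambda>z. f z = Some p"])
  show "w \<in> N e" by (rule N_sym) (simp add: Nw)
next
  fix z e1 assume n: "N e = {w, z, e1}" "z \<noteq> w \<Longrightarrow> f z \<noteq> Some p" "e1 \<noteq> w \<Longrightarrow> f e1 \<noteq> Some p"
  have [simp]: "e \<noteq> u'" "u' \<noteq> e" using N_sym[of u' w] by (auto simp: node_simps)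
  have "playable [(e, p), (w, q)] (erase [(e, p), (w, q)] f)"
    by (simp add: node_simps c n)
  then show False by (rule complete_two) (simp_all add: node_simps)
qed (rule that)

text \<open>A colour of index 3 can be blocked from \<open>u\<close> only at \<open>d1\<close>,
  \<open>t\<close> or \<open>e1\<close>. If \<open>b\<close> differs from \<open>w\<close>, two
  failed recolourings put lower indices on \<open>d1\<close> and \<open>t\<close>, so
  \<open>e1\<close> alone would have to carry both colours of index 3.\<close>

lemma type_two:
  assumes fc: "f c = Some s" and fb: "f b = Some r"
  shows False
proof -
  obtain z e1 where Ne: "N e = {w, z, e1}" and fz: "f z = Some p"
    by (rule obtain_e_nbrs) (simp add: fc facts)
  obtain k d1 where Nd: "N d = {a, k, d1}" and fk: "f k = Some q"
    by (rule obtain_d_nbrs) (simp_all add: fb facts)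
  have "w \<in> N c" "a \<in> N b" by (rule N_sym, simp add: Nw Na)+
  have "\<exists>y\<in>N c. y \<noteq> w \<and> f y = Some p"
    by (rule nbr_color'[OF fc]) (use facts in simp_all)
  with \<open>w \<in> N c\<close> obtain c1 c2 where Nc: "N c = {w, c1, c2}" and fc1: "f c1 = Some p" by (rule nbhd_expand)
  have fc2: "f c2 = Some q"
    using nbr_color[OF fc, of q] by (simp add: facts Nc fc1)
  have "\<exists>y\<in>N b. y \<noteq> a \<and> f y = Some p"
    by (rule nbr_color'[OF fb]) (use facts in simp_all)
  with \<open>a \<in> N b\<close> obtain m t where Nb: "N b = {a, m, t}" and fm: "f m = Some p" by (rule nbhd_expand)
  note [simp] = node_simps Ne fz Nd fk Nc fc1 fc2 Nb fm fc fb
  have block: "f d1 = Some i \<or> f t = Some i \<or> f e1 = Some i" if i: "color_index i = 3" for i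
  proof (rule ccontr)
    assume n: "\<not> ?thesis"
    have "playable [(u, i)] (erase [(u, i)] f)"
      using n i by (simp add: high_neq)
    then show False by (rule complete_one) (use i in \<open>simp_all add: high_neq\<close>)
  qed
  have [simp]: "f t \<noteq> Some r" by (rule valid_neq[OF valid_f fb]) simp
  show False
  proof (cases "b = w")
    case True
    \<comment> \<open>Here \<open>a\<close> and \<open>w\<close> are adjacent, so
      \<open>e = a\<close> and \<open>t = c\<close>. Neither \<open>e1\<close> nor \<open>t\<close>
      has index 3, and \<open>d1\<close> cannot carry two colours.\<close>
    then have "a \<in> N w" using N_sym[of w a] by simp
    then have "e = a" by simp
    then have "e1 \<in> N a" using Ne by blast
    then have "f e1 \<noteq> Some C3a" "f e1 \<noteq> Some C3b" using high_neq[of C3a] high_neq[of C3b] by auto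
    moreover have "c \<in> N b" using True by simp
    then have "t = c" unfolding Nb by simp
    ultimately show False using block[of C3a] block[of C3b] high_neq[of C3a] high_neq[of C3b] by simp
  next
    case False
    have "f t = Some q \<or> f d1 = Some r"
    proof (rule ccontr)
      assume n: "\<not> ?thesis"
      have "playable [(b, q), (a, r), (w, p), (u, q)] (erase [(b, q), (a, r), (w, p), (u, q)] f)"
        using n False by simp
      then show False by (rule complete_one) (use False in simp_all)
    qed
    moreover have "f t = Some s \<or> f d1 = Some s"
    proof (rule ccontr)
      assume n: "\<not> ?thesis"
      have "playable [(a, s), (w, p), (u, q)] (erase [(a, s), (w, p), (u, q)] f)"
        using n False by simp
      then show False by (rule complete_one) (use False in simp_all)
    qed
    ultimately show False
      using block[of C3a] block[of C3b] high_neq[of C3a] high_neq[of C3b] by auto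
  qed
qed

end

section \<open>The pattern in which \<open>c\<close> has colour \<open>p\<close> and
  \<open>b\<close> has colour \<open>s\<close>\<close>

locale stuck_one = stuck_nodes +
  fixes z e1 y c1 k d1 m t
  assumes fc: "f c = Some p" and fb: "f b = Some s"
    and Ne: "N e = {w, z, e1}" "f z = Some p" "z \<noteq> w" "e1 \<noteq> w"
    and Nc: "N c = {w, y, c1}" "f y = Some q" "y \<noteq> w" "c1 \<noteq> w"
    and Nd: "N d = {a, k, d1}" "f k = Some q" "k \<noteq> a" "d1 \<noteq> a"
    and Nb: "N b = {a, m, t}" "f m = Some p" "m \<noteq> a" "t \<noteq> a"
begin

lemma distinct_one: "e \<noteq> a" "e \<noteq> u'" "z \<noteq> u"
proof -
  show 1: "e \<noteq> a" using N_sym[of e w] by (auto simp: node_simps fb)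
  show "e \<noteq> u'" using N_sym[of e w] by (auto simp: node_simps)
  show "z \<noteq> u" using N_sym[of z e] 1 by (auto simp: node_simps Ne)
qed

lemmas one_simps = node_simps fc fb Ne Nc Nd Nb Ne(3-)[symmetric] Nc(3-)[symmetric] Nd(3-)[symmetric] Nb(3-)[symmetric] high_neq
  distinct_one distinct_one[symmetric]

lemma w_to_s: "f e1 = Some s \<or> f c1 = Some s"
proof (rule ccontr)
  assume n: "\<not> ?thesis"
  then have "playable [(w, s)] (erase [(w, s)] f)"
    by (simp add: one_simps)
  then show False by (rule complete_two) (simp_all add: one_simps)
qed

lemma b_to_q: "f t = Some q \<or> f d1 = Some s"
proof (rule ccontr)
  assume n: "\<not> ?thesis"
  have "f t \<noteq> Some s" by (rule valid_neq[OF valid_f fb]) (simp add: Nb)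
  with n have "playable [(b, q), (a, s), (u, q)] (erase [(b, q), (a, s), (u, q)] f)"
    by (simp add: one_simps)
  then show False by (rule complete_one) (simp_all add: one_simps)
qed

lemma u_to_high:
  assumes i: "color_index i = 3"
  shows "f d1 = Some i \<or> f t = Some i \<or> f e1 = Some i \<or> f c1 = Some i"
proof (rule ccontr)
  assume n: "\<not> ?thesis"
  then have "playable [(u, i)] (erase [(u, i)] f)"
    using i by (simp add: one_simps)
  then show False by (rule complete_one) (use i in \<open>simp_all add: one_simps\<close>)
qed

lemma high_pattern:
  obtains i j where "color_index i = 3" "color_index j = 3" "i \<noteq> j"
    "f c1 = Some s \<and> f e1 = Some i \<or> f e1 = Some s \<and> f c1 = Some i"
    "f t = Some q \<and> f d1 = Some j \<or> f d1 = Some s \<and> f t = Some j"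
proof -
  have "\<exists>i j. color_index i = 3 \<and> color_index j = 3 \<and> i \<noteq> j \<and>
    (f c1 = Some s \<and> f e1 = Some i \<or> f e1 = Some s \<and> f c1 = Some i) \<and>
    (f t = Some q \<and> f d1 = Some j \<or> f d1 = Some s \<and> f t = Some j)" (is "\<exists>i j. ?P i j")
  proof -
    have "?P C3a C3b \<or> ?P C3b C3a"
      using w_to_s b_to_q u_to_high[of C3a] u_to_high[of C3b] high_neq[of C3a] high_neq[of C3b] by auto
    then show ?thesis by blast
  qed
  then show ?thesis using that by blast
qed

end

text \<open>\<open>i\<close> is the colour of index 3 on the side of \<open>w\<close>, and
  \<open>j\<close> the one on the side of \<open>a\<close>. The aim is to give \<open>j\<close> to
  \<open>w\<close>, which frees \<open>r\<close> for \<open>v\<close>.\<close>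

locale stuck_pattern = stuck_one +
  fixes i j c2 n
  assumes ij: "color_index i = 3" "color_index j = 3" "i \<noteq> j"
    and pat_d: "f t = Some q \<and> f d1 = Some j \<or> f d1 = Some s \<and> f t = Some j"
    and pat_c: "f c1 = Some s \<and> f e1 = Some i \<or> f e1 = Some s \<and> f c1 = Some i"
    and Nc1: "N c1 = {c, n, c2}" "f n = Some q" "n \<noteq> c" "c2 \<noteq> c"
begin

lemmas ij_neq = ij ij(3)[symmetric] high_neq[OF ij(1)] high_neq[OF ij(2)]

lemma pat_d_neq: "f t \<noteq> Some p" "f t \<noteq> Some r" "f t \<noteq> Some s" "f d1 \<noteq> Some p" "f d1 \<noteq> Some r" "f d1 \<noteq> Some q"
  using pat_d by (auto simp: ij_neq facts)

lemma pat_c_neq: "f c1 \<noteq> Some p" "f c1 \<noteq> Some r" "f c1 \<noteq> Some q" "f e1 \<noteq> Some p" "f e1 \<noteq> Some r" "f e1 \<noteq> Some q"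
    "f c1 \<noteq> Some j" "f e1 \<noteq> Some j"
  using pat_c by (auto simp: ij_neq facts)

lemma distinct_pat: "c \<noteq> d" "y \<noteq> a"
proof -
  show 1: "c \<noteq> d"
  proof
    assume "c = d"
    then have "w \<in> N d" using Nc by simp
    then show False using pat_d_neq by (auto simp: one_simps)
  qed
  show "y \<noteq> a" using N_sym[of y c] 1 by (auto simp: one_simps)
qed

lemmas pat_simps = one_simps ij_neq pat_d_neq pat_c_neq distinct_pat distinct_pat[symmetric] Nc1 Nc1(3-)[symmetric]

text \<open>\<open>c = m\<close> makes \<open>c\<close> adjacent to \<open>b\<close>, hence
  \<open>c1 = b\<close>. Failed recolourings then put \<open>s\<close> and \<open>r\<close> on the
  other neighbours of \<open>y\<close>, after which \<open>y\<close>, \<open>c\<close>,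
  \<open>w\<close>, \<open>u\<close> can be recoloured in turn.\<close>

lemma c_not_m: "c \<noteq> m"
proof
  assume cm: "c = m"
  then have "b \<in> N c" using N_sym[of c b] Nb by simp
  then have "b = c1" by (simp add: pat_simps)
  then have [simp]: "c1 = b" by simp
  have [simp]: "m = c" "f e1 = Some i" using cm pat_c by (auto simp: fb ij_neq)
  obtain g h where Ny: "N y = {c, g, h}" "f g = Some s" "g \<noteq> c" "h \<noteq> c"
  proof (rule nbhd_pick[of c y "\<lambda>x. f x = Some s"])
    show "c \<in> N y" by (rule N_sym) (simp add: Nc)
  next
    fix g h assume *: "N y = {c, g, h}" "g \<noteq> c \<Longrightarrow> f g \<noteq> Some s" "h \<noteq> c \<Longrightarrow> f h \<noteq> Some s"
    have "playable [(b, p), (c, s), (w, p), (u, r)] (erase [(b, p), (c, s), (w, p), (u, r)] f)"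
      by (simp add: pat_simps *)
    then show False by (rule complete_one) (simp_all add: pat_simps)
  qed (rule that)
  have h: "f h = Some r"
  proof (rule ccontr)
    assume "f h \<noteq> Some r"
    then have "playable [(b, p), (c, r), (w, p), (u, s)] (erase [(b, p), (c, r), (w, p), (u, s)] f)"
      by (simp add: pat_simps Ny)
    then show False by (rule complete_one) (simp_all add: pat_simps)
  qed
  \<comment> \<open>The neighbours of \<open>y\<close> coloured \<open>s\<close> and
    \<open>r\<close> tell it apart from \<open>e\<close> and \<open>u'\<close>, which must keep
    their colour \<open>q\<close>.\<close>
  have "g \<notin> N e" by (simp add: pat_simps Ny)
  then have "y \<noteq> e" using Ny by auto
  have "h \<notin> N u'" by (simp add: pat_simps h)
  then have "y \<noteq> u'" using Ny by auto
  with \<open>y \<noteq> e\<close>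
  have "playable [(y, p), (c, q), (w, p), (u, r)] (erase [(y, p), (c, q), (w, p), (u, r)] f)"
    by (simp add: pat_simps Ny h)
  then show False by (rule complete_one) (use \<open>y \<noteq> e\<close> \<open>y \<noteq> u'\<close> in \<open>simp_all add: pat_simps\<close>)
qed

text \<open>Otherwise \<open>c\<close> and \<open>a\<close> could both take \<open>r\<close>,
  leaving \<open>p\<close> for \<open>w\<close> and \<open>q\<close> for \<open>u\<close>. By
  \<open>c_not_m\<close> there is no path of length 2 from \<open>c\<close> to \<open>a\<close>
  through \<open>b\<close>.\<close>

lemma two_hop:
  assumes Ny: "N y = {c, g, h}"
  shows "g \<noteq> w \<and> f g = Some r \<or> h \<noteq> w \<and> f h = Some r \<or> f c2 = Some r"
proof (rule ccontr)
  assume *: "\<not> ?thesis"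
  have g: "g \<noteq> w \<Longrightarrow> f g \<noteq> Some r" and h: "h \<noteq> w \<Longrightarrow> f h \<noteq> Some r" and c2: "f c2 \<noteq> Some r"
    using * by blast+
  have "playable [(c, r), (a, r), (w, p), (u, q)] (erase [(c, r), (a, r), (w, p), (u, q)] f)"
    using c_not_m by (simp add: pat_simps Ny g h c2)
  then show False by (rule complete_one) (simp_all add: pat_simps)
qed

text \<open>The blank alternative covers \<open>y = u'\<close>, which is adjacent to
  \<open>v\<close> and has to keep \<open>q\<close>. In all other cases \<open>y\<close>,
  \<open>c\<close>, \<open>w\<close>, \<open>u\<close> could take \<open>p\<close>,
  \<open>q\<close>, \<open>p\<close>, \<open>r\<close>.\<close>

lemma obtain_y:
  assumes ye: "y \<noteq> e"
  obtains g h where "N y = {c, g, h}" "f g = Some p \<or> f g = None" "g \<noteq> c" "h \<noteq> c"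
proof (rule nbhd_pick[of c y "\<lambda>x. f x = Some p \<or> f x = None"])
  show "c \<in> N y" by (rule N_sym) (simp add: Nc)
next
  fix g h assume *: "N y = {c, g, h}" "g \<noteq> c \<Longrightarrow> \<not> (f g = Some p \<or> f g = None)" "h \<noteq> c \<Longrightarrow> \<not> (f h = Some p \<or> f h = None)"
  have "v \<noteq> c" using f_v fc by force
  have "v \<notin> N y"
  proof
    assume "v \<in> N y"
    then have "v = g \<or> v = h" using *(1) \<open>v \<noteq> c\<close> by simp
    then show False using *(2,3) f_v \<open>v \<noteq> c\<close> by metis
  qed
  then have [simp]: "y \<noteq> u'" "u' \<noteq> y" using Nu' by auto
  have g: "g \<noteq> c \<Longrightarrow> f g \<noteq> Some p" and h: "h \<noteq> c \<Longrightarrow> f h \<noteq> Some p" using *(2,3) by blast+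
  have "playable [(y, p), (c, q), (w, p), (u, r)] (erase [(y, p), (c, q), (w, p), (u, r)] f)"
    using ye by (simp add: pat_simps *(1) g h)
  then show False by (rule complete_one) (use ye in \<open>simp_all add: pat_simps\<close>)
qed (rule that)

lemma y_eq_e_iff: "y = e \<longleftrightarrow> z = c"
proof
  assume "y = e"
  then have "c \<in> N e" using N_sym[of e c] Nc(1) by simp
  then show "z = c" by (simp add: pat_simps eq_commute[of c])
next
  assume "z = c"
  then have "e \<in> N c" using N_sym[of c e] Ne(1) by simp
  then show "y = e" by (simp add: pat_simps eq_commute[of e])
qed

section \<open>Colours forced two steps beyond the neighbours \<open>c\<close> and \<open>e\<close>
  of \<open>w\<close>\<close>

lemma c1_to_p:
  assumes c1: "f c1 = Some s" and Ny: "N y = {c, g, h}"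
  shows "f c2 = Some p \<or> f g = Some s \<or> f h = Some s"
proof (rule ccontr)
  assume *: "\<not> ?thesis"
  have "f c2 \<noteq> Some s" by (rule valid_neq[OF valid_f c1]) (simp add: Nc1)
  with * have "playable [(c1, p), (c, s), (w, p), (u, r)] (erase [(c1, p), (c, s), (w, p), (u, r)] f)"
    by (simp add: pat_simps Ny c1)
  then show False by (rule complete_one) (simp_all add: pat_simps c1)
qed

lemma c_to_s:
  assumes e1: "f e1 = Some s" and Ny: "N y = {c, g, h}"
  shows "f c2 = Some s \<or> f g = Some s \<or> f h = Some s"
proof (rule ccontr)
  assume *: "\<not> ?thesis"
  have "f c1 \<noteq> Some s" using pat_c e1 by (auto simp: ij_neq)
  with * have "playable [(c, s), (w, p), (u, r)] (erase [(c, s), (w, p), (u, r)] f)"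
    by (simp add: pat_simps Ny)
  then show False by (rule complete_one) (simp_all add: pat_simps)
qed

text \<open>\<open>e\<close> is three steps away from \<open>v\<close>, so it may take
  \<open>r\<close> although \<open>v\<close> is to receive \<open>r\<close> as well.\<close>

lemma e_to_r:
  assumes Nz: "N z = {e, l, l2}" and Ne1: "N e1 = {e, o1, e2}"
  shows "f l = Some r \<or> f l2 = Some r \<or> f o1 = Some r \<or> f e2 = Some r"
proof (rule ccontr)
  assume *: "\<not> ?thesis"
  then have "playable [(e, r), (w, q)] (erase [(e, r), (w, q)] f)"
    by (simp add: pat_simps Nz Ne1)
  then show False by (rule complete_two) (simp_all add: pat_simps)
qed

lemma e_to_s:
  assumes "f e1 \<noteq> Some s" and Nz: "N z = {e, l, l2}" and Ne1: "N e1 = {e, o1, e2}"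
  shows "f l = Some s \<or> f l2 = Some s \<or> f o1 = Some s \<or> f e2 = Some s"
proof (rule ccontr)
  assume *: "\<not> ?thesis"
  with assms(1) have "playable [(e, s), (w, q)] (erase [(e, s), (w, q)] f)"
    by (simp add: pat_simps Nz Ne1)
  then show False by (rule complete_two) (simp_all add: pat_simps)
qed

lemma e1_to_q:
  assumes e1: "f e1 = Some s" and Nz: "N z = {e, l, l2}" and Ne1: "N e1 = {e, o1, e2}" "f o1 = Some p"
  shows "f e2 = Some q \<or> f l = Some s \<or> f l2 = Some s"
proof (rule ccontr)
  assume *: "\<not> ?thesis"
  have "f e2 \<noteq> Some s" by (rule valid_neq[OF valid_f e1]) (simp add: Ne1)
  with * have "playable [(e1, q), (e, s), (w, q)] (erase [(e1, q), (e, s), (w, q)] f)"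
    by (simp add: pat_simps Nz Ne1 e1)
  then show False by (rule complete_two) (simp_all add: pat_simps e1)
qed

text \<open>Otherwise \<open>z\<close>, \<open>e\<close>, \<open>w\<close> could take
  \<open>q\<close>, \<open>p\<close>, \<open>q\<close>; \<open>z = c\<close> is excluded because
  \<open>c\<close> is adjacent to \<open>w\<close>.\<close>

lemma obtain_z:
  assumes zc: "z \<noteq> c"
  obtains l l2 where "N z = {e, l, l2}" "f l = Some q"
proof (rule nbhd_pick[of e z "\<lambda>x. f x = Some q"])
  show "e \<in> N z" by (rule N_sym) (simp add: Ne)
next
  fix l l2 assume *: "N z = {e, l, l2}" "l \<noteq> e \<Longrightarrow> f l \<noteq> Some q" "l2 \<noteq> e \<Longrightarrow> f l2 \<noteq> Some q"
  have "playable [(z, q), (e, p), (w, q)] (erase [(z, q), (e, p), (w, q)] f)"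
    using zc by (simp add: pat_simps *)
  then show False by (rule complete_two) (use zc in \<open>simp_all add: pat_simps\<close>)
qed (rule that)

text \<open>Elsewhere within distance 3 of \<open>w\<close> the colour \<open>j\<close> is already
  ruled out, so if these eight vertices miss it, \<open>w\<close> takes \<open>j\<close> and
  \<open>v\<close> takes \<open>r\<close>.\<close>

lemma w_to_high:
  assumes "N y = {c, g, h}" "N z = {e, l, l2}" "N e1 = {e, o1, e2}"
    and "\<forall>x\<in>{g, h, n, c2, l, l2, o1, e2}. f x \<noteq> Some j"
  shows False
proof -
  have "playable [(w, j)] (erase [(w, j)] f)"
    using assms by (simp add: pat_simps)
  then show False by (rule complete_two) (simp_all add: pat_simps)
qed

text \<open>The forced colours fill the eight places of \<open>w_to_high\<close> without using
  \<open>j\<close>: the pairs \<open>h\<close>, \<open>c2\<close> and \<open>l2\<close>,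
  \<open>e2\<close> each meet two demands for different colours, and the other four places are blank
  or have index 1.\<close>

lemma impossible: False
proof -
  obtain ic where ic: "f e1 = Some ic" "color_index ic \<noteq> 1"
    using pat_c by (elim disjE conjE) (simp_all add: idx ij that)
  have "e \<in> N e1" by (rule N_sym) (simp add: Ne)
  moreover have "\<exists>x\<in>N e1. x \<noteq> e \<and> f x = Some p"
    by (rule nbr_color'[OF ic]) (simp_all add: facts fe)
  ultimately obtain o1 e2 where Ne1: "N e1 = {e, o1, e2}" "f o1 = Some p"
    by (rule nbhd_expand)
  note E = w_to_high[OF _ _ Ne1(1)]
  show False
  proof (cases "y = e")
    case True
    \<comment> \<open>Now \<open>w\<close>, \<open>e\<close>, \<open>c\<close> form a triangle, so
      the names in \<open>N y\<close> and \<open>N z\<close> are known already.\<close>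
    then have [simp]: "y = e" "z = c" using y_eq_e_iff by simp_all
    have Ny: "N y = {c, w, e1}" and Nz: "N z = {e, w, c1}" using Ne Nc by auto
    have c2: "f c2 = Some r" using two_hop[OF Ny] by (simp add: pat_simps)
    show False
    proof (cases "f e1 = Some s")
      case True
      then have "f c1 \<noteq> Some s" using pat_c by (auto simp: ij_neq)
      then have "f e2 = Some q" using e1_to_q[OF True Nz Ne1] by (simp add: pat_simps)
      then show False using E[OF Ny Nz] by (simp add: pat_simps c2 Ne1)
    next
      case False
      then have "f c1 = Some s" using pat_c by simp
      from c1_to_p[OF this Ny] False show False by (simp add: pat_simps c2)
    qed
  next
    case False
    then have zc: "z \<noteq> c" using y_eq_e_iff by simp
    obtain g h where Ny: "N y = {c, g, h}" "f g = Some p \<or> f g = None"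
      by (rule obtain_y[OF False])
    obtain l l2 where Nz: "N z = {e, l, l2}" "f l = Some q"
      by (rule obtain_z[OF zc])
    have [simp]: "f g \<noteq> Some r" "f g \<noteq> Some s" "f g \<noteq> Some j" using Ny(2) by (elim disjE; simp add: ij_neq facts)+
    have R: "f h = Some r \<or> f c2 = Some r" using two_hop[OF Ny(1)] by auto
    have R': "f l2 = Some r \<or> f e2 = Some r" using e_to_r[OF Nz(1) Ne1(1)] Nz(2) Ne1(2)
      by (simp add: facts)
    show False
    proof (cases "f e1 = Some s")
      case True
      have "f h = Some s \<or> f c2 = Some s" using c_to_s[OF True Ny(1)] by auto
      moreover have "f e2 = Some q \<or> f l2 = Some s" using e1_to_q[OF True Nz(1) Ne1] Nz(2) by (simp add: facts)
      ultimately show False using E[OF Ny(1) Nz(1)] R R' by (elim disjE; simp add: ij_neq facts Nc1 Nz(2) Ne1(2))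
    next
      case False
      then have "f c1 = Some s" using pat_c by simp
      from c1_to_p[OF this Ny(1)] have "f c2 = Some p \<or> f h = Some s" by auto
      moreover have "f l2 = Some s \<or> f e2 = Some s" using e_to_s[OF False Nz(1) Ne1(1)] Nz(2) Ne1(2)
        by (simp add: facts)
      ultimately show False using E[OF Ny(1) Nz(1)] R R' by (elim disjE; simp add: ij_neq facts Nc1 Nz(2) Ne1(2))
    qed
  qed
qed

end

context stuck_nodes
begin

lemma type_one:
  assumes fc: "f c = Some p" and fb: "f b = Some s"
  shows False
proof -
  obtain z e1 where Ne: "N e = {w, z, e1}" "f z = Some p" "z \<noteq> w" "e1 \<noteq> w"
    by (rule obtain_e_nbrs) (simp add: fc facts)
  obtain k d1 where Nd: "N d = {a, k, d1}" "f k = Some q" "k \<noteq> a" "d1 \<noteq> a"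
    by (rule obtain_d_nbrs) (simp_all add: fb facts)
  have "w \<in> N c" "a \<in> N b" by (rule N_sym, simp add: Nw Na)+
  have "\<exists>y\<in>N b. y \<noteq> a \<and> f y = Some p"
    by (rule nbr_color'[OF fb]) (use facts in simp_all)
  with \<open>a \<in> N b\<close> obtain m t where Nb: "N b = {a, m, t}" "f m = Some p" "m \<noteq> a" "t \<noteq> a"
    by (rule nbhd_expand)
  obtain y c1 where Nc: "N c = {w, y, c1}" "f y = Some q" "y \<noteq> w" "c1 \<noteq> w"
  proof (rule nbhd_pick[of w c "\<lambda>x. f x = Some q"])
    fix y c1 assume *: "N c = {w, y, c1}" "y \<noteq> w \<Longrightarrow> f y \<noteq> Some q" "c1 \<noteq> w \<Longrightarrow> f c1 \<noteq> Some q"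
    have "playable [(c, q), (w, p), (u, r)] (erase [(c, q), (w, p), (u, r)] f)"
      by (simp add: node_simps fc fb *)
    then show False by (rule complete_one) (simp_all add: node_simps fc)
  qed (rule \<open>w \<in> N c\<close>, rule that)
  interpret one: stuck_one V N f v u u' a w a' w' p q r s e c d b z e1 y c1 k d1 m t
    by unfold_locales fact+
  obtain i j where ij: "color_index i = 3" "color_index j = 3" "i \<noteq> j"
    "f c1 = Some s \<and> f e1 = Some i \<or> f e1 = Some s \<and> f c1 = Some i"
    "f t = Some q \<and> f d1 = Some j \<or> f d1 = Some s \<and> f t = Some j"
    by (rule one.high_pattern)
  obtain ic where ic: "f c1 = Some ic" "color_index ic \<noteq> 1"
    using ij(4) by (elim disjE conjE) (simp_all add: idx ij(1) that)
  have "c \<in> N c1" by (rule N_sym) (simp add: Nc)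
  moreover have "\<exists>x\<in>N c1. x \<noteq> c \<and> f x = Some q"
    by (rule nbr_color'[OF ic]) (simp_all add: facts fc)
  ultimately obtain n c2 where Nc1: "N c1 = {c, n, c2}" "f n = Some q" "n \<noteq> c" "c2 \<noteq> c"
    by (rule nbhd_expand)
  interpret pat: stuck_pattern V N f v u u' a w a' w' p q r s e c d b z e1 y c1 k d1 m t i j c2 n
    by unfold_locales fact+
  show False by (rule pat.impossible)
qed

end

lemma (in stuck_path) impossible: False
proof -
  obtain e c d b where nodes: "N w = {u, e, c}" "f e = Some q" "c \<noteq> u"
    "N a = {u, d, b}" "f d = Some p" "d \<noteq> u" "b \<noteq> u"
    and type: "f c = Some p \<and> f b = Some s \<or> f c = Some s \<and> f b = Some r"
    by (rule obtain_nodes)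
  interpret stuck_nodes V N f v u u' a w a' w' p q r s e c d b
    by unfold_locales fact+
  show False using type type_one type_two by blast
qed

lemma (in stuck) impossible: False
proof -
  interpret stuck_path V N f v u u' a w a' w' p q r s
    by unfold_locales (rule no_triangle)
  show False by (rule impossible)
qed

section \<open>Recolouring a vertex of degree 2\<close>

text \<open>\<open>u\<close> is a vertex whose colour has been erased. If that colour was the
  \<open>s\<close> of index 2, \<open>no_escape\<close> expresses that no good colouring of the
  larger graph exists; if it had index 3, minimality rules out every \<open>g\<close> that meets the
  premises.\<close>

locale low_vertex = subcubic_nbhd V N for V :: "'a set" and N +
  fixes f u x y p q r s
  assumes valid_f: "valid f" and f_u: "f u = None"
    and total: "\<And>x. x \<in> V \<Longrightarrow> x \<noteq> u \<Longrightarrow> f x \<noteq> None"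
    and Nu: "N u = {x, y}" and fx: "f x = Some p" and fy: "f y = Some q"
    and idx: "color_index p = 1" "color_index q = 1" "color_index r = 2" "color_index s = 2"
    and pq: "p \<noteq> q" and rs: "r \<noteq> s"
    and nbr_color: "\<And>x c i. f x = Some c \<Longrightarrow> color_index c \<noteq> 1 \<Longrightarrow> color_index i = 1 \<Longrightarrow> \<exists>y\<in>N x. f y = Some i"
    and no_escape: "\<And>g. valid g \<Longrightarrow> \<forall>x\<in>V. g x \<noteq> None \<Longrightarrow> high g \<subseteq> high f \<Longrightarrow>
      \<forall>x. f x = Some s \<longrightarrow> g x = Some s \<Longrightarrow> g u = Some s"
begin

lemma colors_neq: "p \<noteq> r" "p \<noteq> s" "q \<noteq> r" "q \<noteq> s" "r \<noteq> p" "s \<noteq> p" "r \<noteq> q" "s \<noteq> q" "q \<noteq> p" "s \<noteq> r"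
  using idx pq rs by auto

lemma neq_by_color: "f a \<noteq> f b \<Longrightarrow> a = b \<longleftrightarrow> False"
  by auto

lemma swapped: "low_vertex V N f u y x q p r s"
proof -
  have "N u = {y, x}" using Nu by (simp add: insert_commute)
  show ?thesis
    by unfold_locales (fact \<open>N u = {y, x}\<close> valid_f f_u total fy fx idx pq[symmetric] rs nbr_color no_escape)+
qed

lemma escape:
  assumes m: "playable ms (erase ms f)" "u \<in> fst ` set ms"
    and low: "\<forall>m\<in>set ms. color_index (snd m) \<noteq> 3 \<and> f (fst m) \<noteq> Some s" and u: "move ms f u \<noteq> Some s"
  shows False
proof -
  have "valid (move ms f)" using valid_f m(1) by (rule valid_move)
  moreover have "\<forall>x\<in>V. move ms f x \<noteq> None"
  proof
    fix z assume z: "z \<in> V"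
    show "move ms f z \<noteq> None"
    proof (cases "z = u")
      case True
      then show ?thesis using recolor_in[OF m(2)] by fastforce
    next
      case False
      with z show ?thesis using total by (intro move_neq_None) blast
    qed
  qed
  moreover have "high (move ms f) \<subseteq> high f"
  proof
    fix z assume z: "z \<in> high (move ms f)"
    have "z \<notin> fst ` set ms"
    proof
      assume "z \<in> fst ` set ms"
      from recolor_in[OF this, of "erase ms f"] z low show False unfolding high_def by auto
    qed
    with z show "z \<in> high f" by (simp add: high_def recolor_notin erase_notin)
  qed
  moreover have "\<forall>z. f z = Some s \<longrightarrow> move ms f z = Some s"
  proof (intro allI impI)
    fix z assume z: "f z = Some s"
    then have "z \<notin> fst ` set ms" using low by auto
    with z show "move ms f z = Some s" by (simp add: recolor_notin erase_notin)
  qed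
  ultimately show False using no_escape u by blast
qed

lemma nbr_color':
  assumes "f a = Some c" "color_index c \<noteq> 1" "color_index i = 1" "f b \<noteq> Some i"
  shows "\<exists>z\<in>N a. z \<noteq> b \<and> f z = Some i"
  using nbr_color[OF assms(1-3)] assms(4) by metis

lemmas facts = fx fy f_u colors_neq idx pq rs

lemma distinct_nodes: "u \<noteq> x" "u \<noteq> y" "x \<noteq> y"
  using fx fy f_u pq by force+

lemmas node_simps = facts free1 free2 neq_by_color distinct_nodes distinct_nodes[symmetric] Nu

lemma u_in: "u \<in> N x" "u \<in> N y"
  by (rule N_sym, simp add: Nu)+

lemma obtain_x:
  obtains z x1 where "N x = {u, z, x1}" "f z = Some q" "z \<noteq> u" "x1 \<noteq> u"
proof (rule nbhd_pick[of u x "\<lambda>z. f z = Some q"])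
  show "u \<in> N x" by (rule u_in)
next
  fix z x1 assume n: "N x = {u, z, x1}" "z \<noteq> u \<Longrightarrow> f z \<noteq> Some q" "x1 \<noteq> u \<Longrightarrow> f x1 \<noteq> Some q"
  have "playable [(x, q), (u, p)] (erase [(x, q), (u, p)] f)"
    by (simp add: node_simps n)
  then show False by (rule escape) (simp_all add: node_simps)
qed (rule that)

text \<open>The blank alternative covers \<open>z = y\<close>, which is adjacent to
  \<open>u\<close>; otherwise \<open>z\<close>, \<open>x\<close>, \<open>u\<close> could take
  \<open>p\<close>, \<open>q\<close>, \<open>p\<close>.\<close>

lemma obtain_z:
  assumes Nx: "N x = {u, z, x1}" "f z = Some q" "z \<noteq> u" "x1 \<noteq> u" and x1: "f x1 \<noteq> Some p" "f x1 \<noteq> Some q"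
  obtains l l2 where "N z = {x, l, l2}" "f l = Some p \<or> f l = None" "l \<noteq> x" "l2 \<noteq> x"
proof (rule nbhd_pick[of x z "\<lambda>z. f z = Some p \<or> f z = None"])
  show "x \<in> N z" by (rule N_sym) (simp add: Nx)
next
  fix l l2 assume n: "N z = {x, l, l2}" "l \<noteq> x \<Longrightarrow> \<not> (f l = Some p \<or> f l = None)"
    "l2 \<noteq> x \<Longrightarrow> \<not> (f l2 = Some p \<or> f l2 = None)"
  have l: "l \<noteq> x \<Longrightarrow> f l \<noteq> Some p" "l2 \<noteq> x \<Longrightarrow> f l2 \<noteq> Some p" using n(2,3) by blast+
  have "u \<notin> N z"
  proof
    assume "u \<in> N z"
    then have "u = l \<or> u = l2" using n(1) distinct_nodes(1) by simp
    then show False using n(2,3) f_u distinct_nodes(1) by metis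
  qed
  then have [simp]: "z \<noteq> y" "y \<noteq> z" using u_in by auto
  have "playable [(z, p), (x, q), (u, p)] (erase [(z, p), (x, q), (u, p)] f)"
    by (simp add: node_simps Nx Nx(3,4)[symmetric] x1 l n(1))
  then show False by (rule escape) (simp_all add: node_simps Nx Nx(3,4)[symmetric])
qed (rule that)

text \<open>The failures of recolouring \<open>x\<close> with \<open>r\<close>, after
  \<open>x1\<close> has taken \<open>p\<close>, and of recolouring \<open>x\<close> with
  \<open>s\<close> determine \<open>x2\<close> and \<open>l2\<close>. No room for index 3 remains in
  this branch.\<close>

lemma obtain_branch:
  assumes Nx: "N x = {u, z, x1}" "f z = Some q" "z \<noteq> u" "x1 \<noteq> u" and x1: "f x1 = Some r"
  obtains n x2 l l2 where "N x1 = {x, n, x2}" "f n = Some q" "N z = {x, l, l2}" "f l = Some p \<or> f l = None"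
    "f x2 = Some p \<and> f l2 = Some s \<or> f l2 = Some r \<and> f x2 = Some s"
proof -
  obtain l l2 where Nz: "N z = {x, l, l2}" "f l = Some p \<or> f l = None" "l \<noteq> x" "l2 \<noteq> x"
    by (rule obtain_z[OF Nx]) (simp_all add: x1 facts)
  have l: "f l \<noteq> Some r" "f l \<noteq> Some s" using Nz(2) by (elim disjE; simp add: facts)+
  have "x \<in> N x1" by (rule N_sym) (simp add: Nx)
  moreover have "\<exists>n\<in>N x1. n \<noteq> x \<and> f n = Some q"
    by (rule nbr_color'[OF x1]) (simp_all add: facts)
  ultimately obtain n x2 where Nx1: "N x1 = {x, n, x2}" "f n = Some q" "n \<noteq> x" "x2 \<noteq> x"
    by (rule nbhd_expand)
  have x2: "f x2 \<noteq> Some r" by (rule valid_neq[OF valid_f x1]) (simp add: Nx1)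
  have "f x2 = Some p \<or> f l2 = Some r"
  proof (rule ccontr)
    assume "\<not> ?thesis"
    then have "playable [(x1, p), (x, r), (u, p)] (erase [(x1, p), (x, r), (u, p)] f)"
      by (simp add: node_simps Nx Nx(3,4)[symmetric] x1 Nx1 Nz(1) l x2)
    then show False by (rule escape) (simp_all add: node_simps Nx Nx(3,4)[symmetric] x1)
  qed
  moreover have "f x2 = Some s \<or> f l2 = Some s"
  proof (rule ccontr)
    assume "\<not> ?thesis"
    then have "playable [(x, s), (u, p)] (erase [(x, s), (u, p)] f)"
      by (simp add: node_simps Nx Nx(3,4)[symmetric] x1 Nx1 Nz(1) l x2)
    then show False by (rule escape) (simp_all add: node_simps Nx Nx(3,4)[symmetric] x1)
  qed
  ultimately have "f x2 = Some p \<and> f l2 = Some s \<or> f l2 = Some r \<and> f x2 = Some s"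
    using colors_neq by auto
  with Nx1 Nz that show ?thesis by blast
qed

lemma branch_low:
  assumes "N x = {u, z, x1}" "f z = Some q" "z \<noteq> u" "x1 \<noteq> u" "f x1 = Some r" and i: "color_index i = 3"
  shows "\<forall>t\<in>N x1 \<union> N z. f t \<noteq> Some i"
proof -
  obtain n x2 l l2 where *: "N x1 = {x, n, x2}" "f n = Some q" "N z = {x, l, l2}" "f l = Some p \<or> f l = None"
    "f x2 = Some p \<and> f l2 = Some s \<or> f l2 = Some r \<and> f x2 = Some s"
    by (rule obtain_branch[OF assms(1-5)])
  have i': "p \<noteq> i" "q \<noteq> i" "r \<noteq> i" "s \<noteq> i" using i idx by auto
  have "f l \<noteq> Some i" using *(4) i' by auto
  moreover have "f x2 \<noteq> Some i" "f l2 \<noteq> Some i" using *(5) i' by auto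
  ultimately show ?thesis using i' by (simp add: * fx)
qed

lemma u_to_r:
  assumes "N x = {u, z, x1}" "f z = Some q" "z \<noteq> u" "x1 \<noteq> u"
    and "N y = {u, z', y1}" "f z' = Some p" "z' \<noteq> u" "y1 \<noteq> u"
  shows "f x1 = Some r \<or> f y1 = Some r"
proof (rule ccontr)
  assume "\<not> ?thesis"
  then have "playable [(u, r)] (erase [(u, r)] f)"
    using assms by (simp add: node_simps)
  then show False by (rule escape) (simp_all add: node_simps)
qed

lemma u_to_high:
  assumes "N x = {u, z, x1}" "f z = Some q" "N y = {u, z', y1}" "f z' = Some p"
    and i: "color_index i = 3" and "f x1 \<noteq> Some i" "f y1 \<noteq> Some i"
    and "\<forall>t\<in>N x1 \<union> N z. f t \<noteq> Some i" "\<forall>t\<in>N y1 \<union> N z'. f t \<noteq> Some i"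
  shows "free f u i"
proof -
  have "p \<noteq> i" "q \<noteq> i" using i idx by auto
  then show ?thesis using assms by (simp add: free3 node_simps)
qed

lemma y_to_s:
  assumes Nx: "N x = {u, z, x1}" "f z = Some q" "z \<noteq> u" "x1 \<noteq> u"
    and Ny: "N y = {u, z', y1}" "f z' = Some p" "z' \<noteq> u" "y1 \<noteq> u"
    and Ny1: "N y1 = {y, b1, b2}" "N z' = {y, l1, l2}" and y1: "f y1 \<noteq> Some c" "f y1 \<noteq> Some q"
    and c: "c = r \<or> c = s"
  shows "f b1 = Some c \<or> f b2 = Some c \<or> f l1 = Some c \<or> f l2 = Some c"
proof (rule ccontr)
  assume "\<not> ?thesis"
  then have "playable [(y, c), (u, q)] (erase [(y, c), (u, q)] f)"
    using c y1 by (elim disjE; simp add: node_simps Nx(1) Nx(3,4)[symmetric] Ny Ny(3,4)[symmetric] Ny1)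
  then show False by (rule escape) (use c y1 in \<open>elim disjE; simp add: node_simps\<close>)+
qed

text \<open>The branch at \<open>x\<close> contains no colour of index 3, so it is enough that the
  branch at \<open>y\<close> misses one of the two. The cases follow the colour of
  \<open>y1\<close>.\<close>

lemma ex_high:
  assumes x1: "f x1 = Some r" and y1: "f y1 \<noteq> Some s"
    and Nx: "N x = {u, z, x1}" "f z = Some q" "z \<noteq> u" "x1 \<noteq> u"
    and Ny: "N y = {u, z', y1}" "f z' = Some p" "z' \<noteq> u" "y1 \<noteq> u"
  shows "\<exists>i. color_index i = 3 \<and> free f u i"
proof -
  interpret sw: low_vertex V N f u y x q p r s by (rule swapped)
  have bx: "\<forall>t\<in>N x1 \<union> N z. f t \<noteq> Some i" if "color_index i = 3" for i
    by (rule branch_low[OF Nx x1 that])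
  have "y \<in> N y1" by (rule N_sym) (simp add: Ny)
  have yq: "f y1 \<noteq> Some q" by (rule valid_neq[OF valid_f fy]) (simp add: Ny)
  have "y1 \<in> V" using N_V[of y1 y] Ny by simp
  then obtain c where c: "f y1 = Some c" using total Ny(4) by blast
  have fin: ?thesis if "color_index i = 3" "f y1 \<noteq> Some i" "\<forall>t\<in>N y1 \<union> N z'. f t \<noteq> Some i" for i
  proof -
    have "f x1 \<noteq> Some i" using x1 that idx by auto
    then show ?thesis using u_to_high[OF Nx(1,2) Ny(1,2) that(1) _ that(2) bx[OF that(1)] that(3)] that(1) by blast
  qed
  consider "c = r" | "color_index c = 3" | "c = p"
    using color_index_cases[of c] c y1 yq color_index_two_values[of c p q] color_index_two_values[of c r s] idx pq rs
    by metis
  then show ?thesis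
  proof cases
    case 1
    then have "f y1 = Some r" using c by simp
    from sw.branch_low[OF Ny this] show ?thesis using 1 c idx by (intro fin[of C3a]) auto
  next
    case 2
    \<comment> \<open>\<open>r\<close> and \<open>s\<close> occupy the two open places
      \<open>b2\<close> and \<open>l2\<close>, so the colour of \<open>y1\<close> is the only one of
      index 3 on this side.\<close>
    have nq: "f y1 \<noteq> Some p" using 2 c idx by auto
    obtain l1 l2 where Nz: "N z' = {y, l1, l2}" "f l1 = Some q \<or> f l1 = None"
      by (rule sw.obtain_z[OF Ny yq nq])
    have "\<exists>t\<in>N y1. t \<noteq> y \<and> f t = Some p"
      by (rule nbr_color'[OF c]) (use 2 in \<open>simp_all add: facts\<close>)
    with \<open>y \<in> N y1\<close> obtain b1 b2 where Ny1: "N y1 = {y, b1, b2}" "f b1 = Some p" by (rule nbhd_expand)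
    have cn: "c \<noteq> r" "c \<noteq> s" "c \<noteq> q" using 2 idx by auto
    have rr: "f b2 = Some r \<or> f l2 = Some r"
      using y_to_s[OF Nx Ny Ny1(1) Nz(1), of r] Nz(2) Ny1(2) c cn by (auto simp: facts)
    have ss: "f b2 = Some s \<or> f l2 = Some s"
      using y_to_s[OF Nx Ny Ny1(1) Nz(1), of s] Nz(2) Ny1(2) c cn by (auto simp: facts)
    obtain i where i: "color_index i = color_index c" "i \<noteq> c" by (rule other_color)
    have i': "p \<noteq> i" "q \<noteq> i" "r \<noteq> i" "s \<noteq> i" using i 2 idx by auto
    have "f l1 \<noteq> Some i" using Nz(2) i' by auto
    moreover have "f b2 \<noteq> Some i" "f l2 \<noteq> Some i" using rr ss rs i' by auto
    ultimately have "\<forall>t\<in>N y1 \<union> N z'. f t \<noteq> Some i" using i' by (simp add: Nz(1) Ny1 fy)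
    then show ?thesis using i 2 c by (intro fin[of i]) auto
  next
    case 3
    then have y1p: "f y1 = Some p" using c by simp
    obtain b1 b2 where Ny1: "N y1 = {y, b1, b2}" using \<open>y \<in> N y1\<close> by (rule nbhd_any)
    have "y \<in> N z'" by (rule N_sym) (simp add: Ny)
    then obtain l1 l2 where Nz: "N z' = {y, l1, l2}" by (rule nbhd_any)
    \<comment> \<open>Three of the four places are taken by \<open>q\<close> or a blank, by
      \<open>r\<close> and by \<open>s\<close>; the remaining one cannot carry both colours of index
      3.\<close>
    let ?B = "{b1, b2, l1, l2}"
    have "\<exists>t\<in>?B. f t = Some q \<or> f t = None"
    proof (rule ccontr)
      assume n: "\<not> ?thesis"
      have nq: "f b1 \<noteq> Some q" "f b2 \<noteq> Some q" "f l1 \<noteq> Some q" "f l2 \<noteq> Some q" using n by simp_all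
      have np: "f b1 \<noteq> Some p" "f b2 \<noteq> Some p" "f l1 \<noteq> Some p" "f l2 \<noteq> Some p"
        using valid_neq[OF valid_f y1p] valid_neq[OF valid_f Ny(2)] Ny1 Nz by simp_all
      have "u \<notin> N y1" "u \<notin> N z'" using n f_u distinct_nodes(2) unfolding Ny1 Nz by auto
      then have "y1 \<noteq> x" "z' \<noteq> x" using u_in by auto
      then have "playable [(z', q), (y1, q), (y, p), (u, q)] (erase [(z', q), (y1, q), (y, p), (u, q)] f)"
        by (simp add: node_simps Nx(1) Ny Ny(3,4)[symmetric] Nz Ny1 nq np y1p)
      then show False by (rule escape) (use y1p in \<open>simp_all add: node_simps Ny Ny(3,4)[symmetric]\<close>)
    qed
    moreover have "\<exists>t\<in>?B. f t = Some r" "\<exists>t\<in>?B. f t = Some s"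
      using y_to_s[OF Nx Ny Ny1(1) Nz(1), of r] y_to_s[OF Nx Ny Ny1(1) Nz(1), of s] y1p facts by simp_all
    ultimately have slots: "\<exists>t\<in>?B. f t = Some q \<or> f t = None" "\<exists>t\<in>?B. f t = Some r" "\<exists>t\<in>?B. f t = Some s"
      by blast+
    have C3: "C3a \<notin> {p, q, r, s}" "C3b \<notin> {p, q, r, s}" using idx by auto
    have "\<exists>i. color_index i = 3 \<and> (\<forall>t\<in>?B. f t \<noteq> Some i)"
    proof (rule ccontr)
      assume "\<not> ?thesis"
      then have "\<exists>t\<in>?B. f t = Some C3a" "\<exists>t\<in>?B. f t = Some C3b"
        by (metis color_index.simps(5), metis color_index.simps(6))
      moreover obtain e where e: "e \<in> f ` ?B" "e = Some q \<or> e = None" using slots(1) by blast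
      moreover have im: "j \<in> f ` ?B" if "\<exists>t\<in>?B. f t = j" for j
        using that unfolding image_iff by metis
      ultimately have "{e, Some r, Some s, Some C3a, Some C3b} \<subseteq> f ` ?B"
        using im slots(2,3) by (metis empty_subsetI insert_subset)
      then have "card {e, Some r, Some s, Some C3a, Some C3b} \<le> card (f ` ?B)" by (intro card_mono) simp_all
      also have "\<dots> \<le> card ?B" by (rule card_image_le) simp
      also have "\<dots> \<le> 4" using card_length[of "[b1, b2, l1, l2]"] by simp
      also have "card {e, Some r, Some s, Some C3a, Some C3b} = 5"
        using e(2) C3 colors_neq by (elim disjE) (auto simp: card_insert_if)
      finally show False by simp
    qed
    then obtain i where i: "color_index i = 3" "\<forall>t\<in>?B. f t \<noteq> Some i" by blast
    then have "p \<noteq> i" "q \<noteq> i" using idx by auto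
    with i y1p show ?thesis by (intro fin[of i]) (auto simp: Ny1 Nz fy)
  qed
qed

lemma obtain_xy:
  obtains z x1 z' y1 where "N x = {u, z, x1}" "f z = Some q" "z \<noteq> u" "x1 \<noteq> u"
    "N y = {u, z', y1}" "f z' = Some p" "z' \<noteq> u" "y1 \<noteq> u" "f x1 = Some r \<or> f y1 = Some r"
proof -
  interpret sw: low_vertex V N f u y x q p r s by (rule swapped)
  obtain z x1 where Nx: "N x = {u, z, x1}" "f z = Some q" "z \<noteq> u" "x1 \<noteq> u" by (rule obtain_x)
  obtain z' y1 where Ny: "N y = {u, z', y1}" "f z' = Some p" "z' \<noteq> u" "y1 \<noteq> u" by (rule sw.obtain_x)
  from u_to_r[OF Nx Ny] Nx Ny that show ?thesis by blast
qed

lemma ex_free_high: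
  assumes s: "\<forall>a\<in>N u. \<forall>b\<in>N a. f b \<noteq> Some s"
  shows "\<exists>i. color_index i = 3 \<and> free f u i"
proof -
  interpret sw: low_vertex V N f u y x q p r s by (rule swapped)
  obtain z x1 z' y1 where Nx: "N x = {u, z, x1}" "f z = Some q" "z \<noteq> u" "x1 \<noteq> u"
    and Ny: "N y = {u, z', y1}" "f z' = Some p" "z' \<noteq> u" "y1 \<noteq> u"
    and r: "f x1 = Some r \<or> f y1 = Some r" by (rule obtain_xy)
  have "f x1 \<noteq> Some s" "f y1 \<noteq> Some s" using s Nu Nx Ny by simp_all
  with r show ?thesis using ex_high[OF _ _ Nx Ny] sw.ex_high[OF _ _ Ny Nx] by blast
qed

text \<open>With \<open>r\<close> and \<open>s\<close> interchangeable, \<open>x1\<close> and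
  \<open>y1\<close> carry one of them each, and neither branch contains a colour of index 3.\<close>

lemma free_high:
  assumes other: "low_vertex V N f u x y p q s r" and i: "color_index i = 3"
  shows "free f u i"
proof -
  interpret sw: low_vertex V N f u y x q p r s by (rule swapped)
  interpret ot: low_vertex V N f u x y p q s r by (rule other)
  interpret os: low_vertex V N f u y x q p s r by (rule ot.swapped)
  obtain z x1 z' y1 where Nx: "N x = {u, z, x1}" "f z = Some q" "z \<noteq> u" "x1 \<noteq> u"
    and Ny: "N y = {u, z', y1}" "f z' = Some p" "z' \<noteq> u" "y1 \<noteq> u"
    and r: "f x1 = Some r \<or> f y1 = Some r" by (rule obtain_xy)
  have s: "f x1 = Some s \<or> f y1 = Some s" by (rule ot.u_to_r[OF Nx Ny])
  have neq: "r \<noteq> i" "s \<noteq> i" using i idx by auto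
  consider "f x1 = Some r" "f y1 = Some s" | "f x1 = Some s" "f y1 = Some r"
    using r s rs by auto
  then show ?thesis
  proof cases
    case 1
    then show ?thesis
      by (intro u_to_high[OF Nx(1,2) Ny(1,2) i] branch_low[OF Nx _ i] os.branch_low[OF Ny _ i]) (simp_all add: neq)
  next
    case 2
    then show ?thesis
      by (intro u_to_high[OF Nx(1,2) Ny(1,2) i] ot.branch_low[OF Nx _ i] sw.branch_low[OF Ny _ i]) (simp_all add: neq)
  qed
qed

end

section \<open>Putting back the deleted vertex\<close>

context subcubic_nbhd
begin

lemma valid_submap:
  assumes "valid g" "\<And>x c. h x = Some c \<Longrightarrow> g x = Some c"
  shows "valid h"
  using assms unfolding valid_def by (metis free_mono)

lemma good_extend:
  assumes g: "valid g" "g v = None" "\<And>x. x \<in> V \<Longrightarrow> x \<noteq> v \<Longrightarrow> g x \<noteq> None"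
    and Nv: "N v = {u, u'}" and high: "u \<in> high g \<Longrightarrow> u' \<in> high g \<Longrightarrow> u = u'"
    and i: "color_index i \<noteq> 3" "free g v i"
  shows "good (g(v := Some i)) v"
proof -
  have "valid (g(v := Some i))" using g(1) i(2) by (rule valid_set)
  moreover have "v \<notin> N v" by (rule N_irrefl)
  then have "u \<noteq> v" "u' \<noteq> v" using Nv by auto
  then have "y = z" if "y \<in> N v \<inter> high (g(v := Some i))" "z \<in> N v \<inter> high (g(v := Some i))" for y z
    using that high unfolding Nv high_def by auto
  moreover have "v \<notin> high (g(v := Some i))" using i by (simp add: high_def)
  ultimately show ?thesis using g(3) unfolding good_def by auto
qed

text \<open>The colours of index 1 are exhausted at \<open>v\<close> only if \<open>u\<close> and
  \<open>u'\<close> carry both of them.\<close>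

lemma good_extend_one:
  assumes g: "valid g" "g v = None" "\<And>x. x \<in> V \<Longrightarrow> x \<noteq> v \<Longrightarrow> g x \<noteq> None"
    and Nv: "N v = {u, u'}" and high: "u \<in> high g \<Longrightarrow> u' \<in> high g \<Longrightarrow> u = u'"
    and c: "g u = Some c" "g u' = Some c'" and one: "color_index c = 1 \<Longrightarrow> color_index c' = 1 \<Longrightarrow> c = c'"
  shows "\<exists>g. good g v"
proof -
  have "\<exists>i. color_index i = 1 \<and> i \<noteq> c \<and> i \<noteq> c'"
  proof (cases "color_index c = 1")
    case True
    obtain i where "color_index i = color_index c" "i \<noteq> c" by (rule other_color)
    with True one show ?thesis by auto
  next
    case False
    have "C1a \<noteq> c" "C1b \<noteq> c" using False by auto
    moreover have "C1a \<noteq> c' \<or> C1b \<noteq> c'" by auto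
    ultimately show ?thesis by (metis color_index.simps(1,2))
  qed
  then obtain i where i: "color_index i = 1" "i \<noteq> c" "i \<noteq> c'" by blast
  then have "free g v i" using c by (simp add: free1 Nv)
  then have "good (g(v := Some i)) v" using i(1) by (intro good_extend[OF g Nv high]) simp_all
  then show ?thesis by blast
qed

text \<open>Collects the obstructions that make up \<open>stuck\<close>: the fact
  \<open>recolor\<close> yields \<open>a\<close> and \<open>a'\<close>, and \<open>two\<close>
  yields the colours of \<open>w\<close> and \<open>w'\<close>.\<close>

lemma good_extend_distinct:
  assumes f: "valid f" "f v = None" "\<And>x. x \<in> V \<Longrightarrow> x \<noteq> v \<Longrightarrow> f x \<noteq> None"
    and Nv: "N v = {u, u'}" and fu: "f u = Some p" and fu': "f u' = Some q"
    and idx: "color_index p = 1" "color_index q = 1" and pq: "p \<noteq> q"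
    and nbr_color: "\<And>x c i. f x = Some c \<Longrightarrow> color_index c \<noteq> 1 \<Longrightarrow> color_index i = 1 \<Longrightarrow> \<exists>y\<in>N x. f y = Some i"
  shows "\<exists>g. good g v"
proof (rule ccontr)
  assume no: "\<not> ?thesis"
  have v_in: "v \<in> N u" "v \<in> N u'" by (rule N_sym, simp add: Nv)+
  have low: "u \<notin> high f" "u' \<notin> high f" using fu fu' idx by (simp_all add: high_def)
  have uu': "u \<noteq> u'" using fu fu' pq by auto
  have uv: "u \<noteq> v" "u' \<noteq> v" using fu fu' f(2) by auto
  have recolor: "\<exists>z\<in>N x. z \<noteq> v \<and> f z = Some j"
    if x: "{x, y} = {u, u'}" "f x = Some i" "f y = Some j" for x y i j
  proof (rule ccontr)
    assume n: "\<not> ?thesis"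
    have j: "color_index j = 1" using x(1,3) fu fu' idx by (auto simp: doubleton_eq_iff)
    have "free f x j" using j n f(2) by (auto simp: free1)
    then have "valid (f(x := Some j))" using f(1) by (intro valid_set)
    moreover have "x \<noteq> v" "y \<noteq> v" using x(1) uv by (auto simp: doubleton_eq_iff)
    moreover have "N v = {x, y}" using x(1) Nv by simp
    ultimately have "\<exists>g. good g v" using f x j
      by (intro good_extend_one[of "f(x := Some j)" v x y j j]) (auto simp: high_def)
    then show False using no by blast
  qed
  obtain a w where Nu: "N u = {v, a, w}" "f a = Some q" "a \<noteq> v" "w \<noteq> v"
    using v_in(1) recolor[of u u', OF refl fu fu'] by (rule nbhd_expand)
  obtain a' w' where Nu': "N u' = {v, a', w'}" "f a' = Some p" "a' \<noteq> v" "w' \<noteq> v"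
    using v_in(2) recolor[of u' u, OF insert_commute fu' fu] by (rule nbhd_expand)
  have two: "f w = Some c \<or> f w' = Some c" if c: "color_index c = 2" for c
  proof (rule ccontr)
    assume n: "\<not> ?thesis"
    have "p \<noteq> c" "q \<noteq> c" using c idx by auto
    then have "free f v c" using n c f(2) fu fu' Nu Nu' by (simp add: free2 Nv)
    then have "good (f(v := Some c)) v" using c low by (intro good_extend[OF f Nv]) simp_all
    then show False using no by blast
  qed
  obtain r s where rs: "f w = Some r" "f w' = Some s" "color_index r = 2" "color_index s = 2" "r \<noteq> s"
    using two[of C2a] two[of C2b] by fastforce
  have no': "\<not> good g v" for g using no by blast
  interpret stuck V N f v u u' a w a' w' p q r s
    by unfold_locales (fact f Nv Nu Nu' fu fu' rs idx pq nbr_color no')+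
  show False by (rule impossible)
qed

section \<open>Colourings with the fewest vertices of index 3, then of index 2\<close>

lemma ex_minimal:
  assumes "good f0 u"
  obtains f where "good f u" "\<And>x. x \<notin> V \<Longrightarrow> f x = None"
    "\<And>g. valid g \<Longrightarrow> \<forall>x\<in>V. g x \<noteq> None \<Longrightarrow> high g \<subset> high f \<Longrightarrow> False"
    "\<And>x c i. f x = Some c \<Longrightarrow> color_index c \<noteq> 1 \<Longrightarrow> color_index i = 1 \<Longrightarrow> \<exists>y\<in>N x. f y = Some i"
proof -
  define R where "R g = {x \<in> V. \<exists>c. g x = Some c \<and> color_index c \<noteq> 1}" for g :: "'a \<Rightarrow> color option"
  \<comment> \<open>A lexicographic order in one number: \<open>R g\<close> has at most
    \<open>card V\<close> elements, so \<open>card (high g)\<close> dominates. Among equal values of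
    the latter, \<open>R\<close> compares the numbers of vertices of index 2.\<close>
  define m where "m g = card (high g) * Suc (card V) + card (R g)" for g
  define P where "P g \<longleftrightarrow> good g u \<and> (\<forall>x. x \<notin> V \<longrightarrow> g x = None)" for g
  \<comment> \<open>Beyond validity and totality, goodness only bounds the high set from above, so
    it passes to smaller high sets. Erasing values outside \<open>V\<close> keeps
    \<open>high\<close> finite.\<close>
  have P_restrict: "P (\<lambda>x. if x \<in> V then g x else None)"
    if "valid g" "\<forall>x\<in>V. g x \<noteq> None" "high g \<subseteq> high f" "good f u" for g f
  proof -
    let ?h = "\<lambda>x. if x \<in> V then g x else None"
    have "high ?h \<subseteq> high g" by (auto simp: high_def)
    then have "high ?h \<subseteq> high f" using that by blast
    moreover have "valid ?h" by (rule valid_submap[OF that(1)]) (simp split: if_splits)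
    ultimately show ?thesis using that unfolding P_def good_def by (auto 0 3)
  qed
  have "P (\<lambda>x. if x \<in> V then f0 x else None)"
    by (rule P_restrict) (use assms in \<open>simp_all add: good_def\<close>)
  then obtain f where f: "P f" and least: "\<And>g. P g \<Longrightarrow> m f \<le> m g"
    using ex_has_least_nat[of P _ m] by blast
  have good: "good f u" and out: "\<And>x. x \<notin> V \<Longrightarrow> f x = None" using f by (auto simp: P_def)
  have "high f \<subseteq> V" using out unfolding high_def by fastforce
  then have fin: "finite (high f)" using finite_V by (rule finite_subset)
  have least': "m f \<le> m (\<lambda>x. if x \<in> V then g x else None)"
    if "valid g" "\<forall>x\<in>V. g x \<noteq> None" "high g \<subseteq> high f" for g
    by (rule least[OF P_restrict[OF that good]])
  have high_r: "high (\<lambda>x. if x \<in> V then g x else None) \<subseteq> high g" for g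
    by (auto simp: high_def)
  have R_r: "R (\<lambda>x. if x \<in> V then g x else None) = R g" for g
    by (auto simp: R_def)
  have card_R: "card (R g) \<le> card V" for g
    unfolding R_def by (rule card_mono[OF finite_V]) auto
  show ?thesis
  proof (rule that[OF good out])
    fix g assume g: "valid g" "\<forall>x\<in>V. g x \<noteq> None" "high g \<subset> high f"
    let ?h = "\<lambda>x. if x \<in> V then g x else None"
    have "high ?h \<subset> high f" using g(3) high_r[of g] by blast
    then have "Suc (card (high ?h)) \<le> card (high f)" using fin psubset_card_mono by (metis Suc_leI)
    then have "Suc (card (high ?h)) * Suc (card V) \<le> card (high f) * Suc (card V)" by (rule mult_le_mono1)
    then have "m ?h < m f" unfolding m_def using card_R[of ?h] by simp
    moreover have "m f \<le> m ?h" using g by (intro least') auto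
    ultimately show False by simp
  next
    fix x c i assume x: "f x = Some c" "color_index c \<noteq> 1" and i: "color_index i = 1"
    show "\<exists>y\<in>N x. f y = Some i"
    proof (rule ccontr)
      assume "\<not> ?thesis"
      then have "free f x i" using i by (simp add: free1)
      then have v: "valid (f(x := Some i))" using good by (intro valid_set) (simp_all add: good_def)
      let ?h = "\<lambda>z. if z \<in> V then (f(x := Some i)) z else None"
      have xV: "x \<in> V" using x out by force
      have hi: "high (f(x := Some i)) \<subseteq> high f" using i by (auto simp: high_def split: if_splits)
      have "m f \<le> m ?h" by (rule least'[OF v _ hi]) (use good in \<open>simp add: good_def\<close>)
      moreover have "card (high ?h) \<le> card (high f)"
        using hi high_r[of "f(x := Some i)"] fin by (intro card_mono) blast+
      moreover have "R (f(x := Some i)) \<subset> R f" using x xV i by (auto simp: R_def split: if_splits)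
      then have "card (R ?h) < card (R f)" unfolding R_r
        by (rule psubset_card_mono[rotated]) (simp add: R_def finite_V)
      ultimately have "card (high f) * Suc (card V) + card (R f) \<le> card (high ?h) * Suc (card V) + card (R ?h)"
        "card (high ?h) * Suc (card V) \<le> card (high f) * Suc (card V)"
        unfolding m_def by (simp, intro mult_le_mono1)
      with \<open>card (R ?h) < card (R f)\<close> show False by linarith
    qed
  qed
qed

section \<open>Deleting a vertex and lifting colourings back\<close>

definition del :: "'a \<Rightarrow> 'a \<Rightarrow> 'a set" where
  "del v x = (if x = v then {} else N x - {v})"

lemma nbhd_del: "subcubic_nbhd (V - {v}) (del v)"
proof
  show "finite (V - {v})" using finite_V by simp
  show "card (del v x) \<le> 3" for x
  proof -
    have "card (del v x) \<le> card (N x)" by (intro card_mono finite_N) (auto simp: del_def)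
    then show ?thesis using card_N[of x] by simp
  qed
  show "y \<in> V - {v}" if "y \<in> del v x" for x y using that N_V[of y x] by (simp add: del_def split: if_splits)
  show "x \<in> del v y" if "y \<in> del v x" for x y using that N_sym[of y x] by (simp add: del_def split: if_splits)
  show "x \<notin> del v x" for x by (simp add: del_def N_irrefl)
qed

text \<open>Only walks through the blank vertex \<open>v\<close> are new. With at most three steps
  they join \<open>u\<close> to \<open>u'\<close>, or one of these to a neighbour of the other,
  which explains the conditions on \<open>c\<close> and \<open>d\<close>.\<close>

lemma valid_lift:
  assumes g: "subcubic_nbhd.valid (del v) g" "g v = None" and Nv: "N v = {u, u'}" "u \<noteq> u' \<Longrightarrow> g u = Some c"
    and same: "u \<noteq> u' \<Longrightarrow> g u' = Some c \<Longrightarrow> color_index c = 1"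
    and high: "u \<noteq> u' \<Longrightarrow> color_index c = 3 \<Longrightarrow> \<forall>y\<in>N u'. y \<noteq> u \<longrightarrow> g y \<noteq> Some c"
    and high': "\<And>d. u \<noteq> u' \<Longrightarrow> g u' = Some d \<Longrightarrow> color_index d = 3 \<Longrightarrow> \<forall>y\<in>N u. y \<noteq> u' \<longrightarrow> g y \<noteq> Some d"
  shows "valid g"
  unfolding valid_def
proof (intro allI impI)
  fix x i assume x: "g x = Some i"
  then have xv: "x \<noteq> v" using g(2) by auto
  interpret H: subcubic_nbhd "V - {v}" "del v" by (rule nbhd_del)
  have Hd: "H.free g x i" using g(1) x unfolding H.valid_def by blast
  note Hd = Hd[unfolded H.free_def]
  have pair: "u \<noteq> u' \<and> (x = u \<and> z = u' \<and> i = c \<or> x = u' \<and> z = u)" if "x \<in> N v" "z \<in> N v" "z \<noteq> x" for z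
  proof -
    have "x = u \<and> z = u' \<or> x = u' \<and> z = u" "u \<noteq> u'" using that unfolding Nv(1) by auto
    then show ?thesis using Nv(2) x by auto
  qed
  have through: "g z \<noteq> Some i" if "2 \<le> color_index i" "z \<in> N v" "z \<noteq> x" "x \<in> N v" for z
    using pair[OF that(4,2,3)]
  proof (elim conjE disjE)
    assume "u \<noteq> u'" "x = u" "z = u'" "i = c"
    then show ?thesis using same that(1) by auto
  next
    assume "u \<noteq> u'" "x = u'" "z = u"
    then show ?thesis using same Nv(2) x that(1) by auto
  qed
  have far: "g t \<noteq> Some i" if "x \<in> N v" "z \<in> N v" "z \<noteq> x" "t \<in> N z" "t \<noteq> x" "color_index i = 3" for z t
    using pair[OF that(1,2,3)]
  proof (elim conjE disjE)
    assume "u \<noteq> u'" "x = u" "z = u'" "i = c"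
    then show ?thesis using high that by blast
  next
    assume "u \<noteq> u'" "x = u'" "z = u"
    then show ?thesis using high' x that by blast
  qed
  have del: "y \<in> del v x' \<longleftrightarrow> y \<in> N x' \<and> y \<noteq> v" if "x' \<noteq> v" for x' y
    using that by (simp add: del_def)
  show "free g x i" unfolding free_def
  proof (intro ballI conjI impI)
    fix y assume y: "y \<in> N x"
    show "g y \<noteq> Some i" using Hd y xv g(2) by (cases "y = v") (simp_all add: del)
    assume i2: "2 \<le> color_index i"
    fix z assume z: "z \<in> N y" "z \<noteq> x"
    show z': "g z \<noteq> Some i"
    proof (cases "y = v \<or> z = v")
      case True
      then show ?thesis using through[OF i2] N_sym[OF y] z g(2) by auto
    next
      case False
      then have "y \<in> del v x" "z \<in> del v y" using y z xv by (simp_all add: del)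
      then show ?thesis using Hd z(2) i2 by blast
    qed
    assume i3: "3 \<le> color_index i"
    then have i3': "color_index i = 3" using color_index_cases[of i] by auto
    fix t assume t: "t \<in> N z" "t \<noteq> x"
    show "g t \<noteq> Some i"
    proof (cases "y = v")
      case True
      then show ?thesis using far[of z t] N_sym[OF y] z t i3' by blast
    next
      case yv: False
      show ?thesis
      proof (cases "z = v")
        \<comment> \<open>The walk is \<open>x\<close>, \<open>y\<close>, \<open>v\<close>,
          \<open>t\<close>, so \<open>y\<close> and \<open>t\<close> are the two neighbours of
          \<open>v\<close>.\<close>
        case True
        show ?thesis
        proof
          assume gt: "g t = Some i"
          have *: "y \<in> N v" "t \<in> N v" using z(1) t(1) N_sym True by blast+
          have "t \<noteq> y" using \<open>g y \<noteq> Some i\<close> gt by blast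
          with * have uu': "u \<noteq> u'" "y = u \<and> t = u' \<or> y = u' \<and> t = u" unfolding Nv(1) by auto
          from uu'(2) have "g x \<noteq> Some i"
          proof (elim conjE disjE)
            assume "y = u" "t = u'"
            then have "g u' = Some i" "x \<in> N u" "x \<noteq> u'" using gt N_sym[OF y] t(2) by auto
            then show ?thesis using high'[OF uu'(1) _ i3'] by blast
          next
            assume "y = u'" "t = u"
            moreover have "i = c" using gt Nv(2)[OF uu'(1)] \<open>t = u\<close> by simp
            ultimately have "color_index c = 3" "x \<in> N u'" "x \<noteq> u" using i3' N_sym[OF y] t(2) by auto
            then show ?thesis using high[OF uu'(1)] \<open>i = c\<close> by blast
          qed
          then show False using x by simp
        qed
      next
        case zv: False
        show ?thesis
        proof (cases "t = v")
          case True
          then show ?thesis using g(2) by simp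
        next
          case False
          then have "y \<in> del v x" "z \<in> del v y" "t \<in> del v z" using y z t xv yv zv by (simp_all add: del)
          then show ?thesis using Hd z(2) t(2) i2 i3 by blast
        qed
      qed
    qed
  qed
qed

lemma del_eq:
  assumes "v \<in> N x" "a \<in> del v x" "b \<in> del v x" "a \<noteq> b"
  shows "del v x = {a, b}"
proof -
  have x: "x \<noteq> v" using assms(2) by (auto simp: del_def)
  have sub: "{v, a, b} \<subseteq> N x" and neq: "a \<noteq> v" "b \<noteq> v" using assms by (auto simp: del_def split: if_splits)
  have "card {v, a, b} = 3" using neq assms(4) by simp
  then have "{v, a, b} = N x" using card_subset_eq[OF finite_N sub] card_N[of x] card_mono[OF finite_N sub] by simp
  then show ?thesis using neq x by (auto simp: del_def)
qed

lemma extend_good: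
  assumes u: "u \<in> N v" and Nv: "N v = {u, u'}" and f0: "subcubic_nbhd.good (V - {v}) (del v) f0 u"
  shows "\<exists>g. good g v"
proof -
  interpret H: subcubic_nbhd "V - {v}" "del v" by (rule nbhd_del)
  obtain f where f: "H.good f u" and out: "\<And>x. x \<notin> V - {v} \<Longrightarrow> f x = None"
    and M: "\<And>g. H.valid g \<Longrightarrow> \<forall>x\<in>V - {v}. g x \<noteq> None \<Longrightarrow> high g \<subset> high f \<Longrightarrow> False"
    and nbr: "\<And>x c i. f x = Some c \<Longrightarrow> color_index c \<noteq> 1 \<Longrightarrow> color_index i = 1 \<Longrightarrow> \<exists>y\<in>del v x. f y = Some i"
    using H.ex_minimal[OF f0] by blast
  have valid: "H.valid f" and total: "\<And>x. x \<in> V \<Longrightarrow> x \<noteq> v \<Longrightarrow> f x \<noteq> None" and u_low: "u \<notin> high f"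
    and one_high: "\<And>y z. y \<in> del v u \<inter> high f \<Longrightarrow> z \<in> del v u \<inter> high f \<Longrightarrow> y = z"
    using f unfolding H.good_def by blast+
  have f_v: "f v = None" by (rule out) simp
  have v_in: "v \<in> N u" "v \<in> N u'" by (rule N_sym, simp add: Nv)+
  have uv: "u \<noteq> v" "u' \<noteq> v" using N_irrefl[of v] Nv by auto
  have inV: "u \<in> V" "u' \<in> V" using N_V Nv by blast+
  obtain c c' where c: "f u = Some c" "f u' = Some c'" using total inV uv by blast
  have del_N: "y \<in> del v x \<longleftrightarrow> y \<in> N x \<and> y \<noteq> v" if "x \<noteq> v" for x y using that by (simp add: del_def)
  have c3: "color_index c \<noteq> 3" using u_low c by (simp add: high_def)
  \<comment> \<open>Having lost \<open>v\<close>, such an \<open>x\<close> has at most two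
    neighbours, and by minimality both colours of index 1 are among them.\<close>
  have ones: "\<exists>a b. del v x = {a, b} \<and> f a = Some C1a \<and> f b = Some C1b"
    if x: "v \<in> N x" "f x = Some i" "color_index i \<noteq> 1" for x i
  proof -
    obtain a where a: "a \<in> del v x" "f a = Some C1a" using nbr[OF x(2,3), of C1a] by auto
    obtain b where b: "b \<in> del v x" "f b = Some C1b" using nbr[OF x(2,3), of C1b] by auto
    have "a \<noteq> b" using a b by auto
    then show ?thesis using del_eq[OF x(1) a(1) b(1)] a b by blast
  qed
  have low_nbr: "f y \<noteq> Some d" if nb: "v \<in> N x" "f x = Some i" "color_index i \<noteq> 1" "x \<noteq> v" "y \<in> N x" "color_index d = 3" for x i y d
  proof (cases "y = v")
    case False
    then have "y \<in> del v x" using nb del_N by blast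
    moreover obtain a b where "del v x = {a, b}" "f a = Some C1a" "f b = Some C1b" using ones[OF nb(1,2,3)] by blast
    ultimately have "f y = Some C1a \<or> f y = Some C1b" by auto
    then show ?thesis using nb(6) by auto
  qed (use f_v in simp)
  have finish: "\<exists>g. good g v" if "valid f" "color_index c = 1 \<Longrightarrow> color_index c' = 1 \<Longrightarrow> c = c'"
    using good_extend_one[OF that(1) f_v total Nv _ c that(2)] u_low by blast
  show ?thesis
  proof (cases "u = u'")
    case True
    then have "valid f" by (intro valid_lift[OF valid f_v Nv, of c]) simp_all
    then show ?thesis using True c by (intro finish) auto
  next
    case uu': False
    show ?thesis
    proof (cases "c = c'")
      case same: True
      show ?thesis
      proof (cases "color_index c = 1")
        case True
        then have "valid f" using c uu' same
          by (intro valid_lift[OF valid f_v Nv, of c]) auto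
        then show ?thesis using same by (intro finish)
      next
        case False
        with c3 have c2: "color_index c = 2" using color_index_cases[of c] by blast
        obtain r where r: "color_index r = color_index c" "r \<noteq> c" by (rule other_color)
        obtain x y where xy: "del v u = {x, y}" "f x = Some C1a" "f y = Some C1b"
          using ones[OF v_in(1) c(1) False] by blast
        let ?f = "f(u := None)"
        \<comment> \<open>\<open>u\<close> moves to \<open>d\<close> while \<open>u'\<close> keeps
          its colour of index 2; so \<open>d\<close> may even have index 3, and index 1 is available
          for \<open>v\<close>.\<close>
        have finish': "\<exists>g. good g v" if g: "H.valid g" "\<forall>x\<in>V - {v}. g x \<noteq> None" "g u = Some d" "d \<noteq> c" "g u' = Some c"
          "color_index d = 3 \<Longrightarrow> \<forall>y\<in>N u'. y \<noteq> v \<longrightarrow> g y \<noteq> Some d" for g d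
        proof -
          let ?g = "g(v := None)"
          have "H.valid ?g" using g(1) by (rule H.valid_erase)
          then have "valid ?g"
            by (rule valid_lift[OF _ _ Nv, of _ d]) (use g uv c2 in auto)
          then show ?thesis
            by (rule good_extend_one[OF _ _ _ Nv, of _ d c]) (use g uv c2 in \<open>auto simp: high_def\<close>)
        qed
        show ?thesis
        proof (rule ccontr)
          assume no: "\<not> ?thesis"
          \<comment> \<open>Here \<open>s\<close> is the shared colour \<open>c\<close>, and
            \<open>no_escape\<close> follows from the assumption that \<open>v\<close> cannot be put
            back.\<close>
          interpret low: low_vertex "V - {v}" "del v" ?f u x y C1a C1b r c
          proof unfold_locales
            show "H.valid ?f" using valid by (rule H.valid_erase)
            show "del v u = {x, y}" by (rule xy)
            have "u \<notin> del v u" by (rule H.N_irrefl)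
            then show "?f x = Some C1a" "?f y = Some C1b" using xy by auto
            show "\<exists>y\<in>del v x. ?f y = Some i" if x: "?f x = Some d" "color_index d \<noteq> 1" "color_index i = 1" for x d i
            proof -
              have "f x = Some d" using x(1) by (simp split: if_splits)
              from nbr[OF this x(2,3)] obtain z where "z \<in> del v x" "f z = Some i" by blast
              moreover from this have "z \<noteq> u" using c c2 x(3) by auto
              ultimately show ?thesis by auto
            qed
            fix g assume g: "H.valid g" "\<forall>x\<in>V - {v}. g x \<noteq> None" "high g \<subseteq> high ?f" "\<forall>x. ?f x = Some c \<longrightarrow> g x = Some c"
            show "g u = Some c"
            proof (rule ccontr)
              assume n: "g u \<noteq> Some c"
              obtain d where d: "g u = Some d" using g(2) inV uv by blast
              have "u \<notin> high g" using g(3) by (auto simp: high_def)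
              then have "color_index d \<noteq> 3" using d by (simp add: high_def)
              moreover have "g u' = Some c" using g(4) c same uu' by auto
              ultimately show False using finish'[OF g(1,2) d] n d no by auto
            qed
          qed (use r c2 total in auto)
          have "\<forall>a\<in>del v u. \<forall>b\<in>del v a. ?f b \<noteq> Some c"
            using H.valid_neq2[OF valid c(1)] c2 by auto
          then obtain i where i: "color_index i = 3" "H.free ?f u i" using low.ex_free_high by blast
          have "H.valid (?f(u := Some i))" using low.valid_f i(2) by (rule H.valid_set)
          then have "H.valid (f(u := Some i))" by simp
          then have "\<exists>g. good g v"
          proof (rule finish'[of _ i])
            show "\<forall>y\<in>N u'. y \<noteq> v \<longrightarrow> (f(u := Some i)) y \<noteq> Some i"
            proof (intro ballI impI)
              fix y assume y: "y \<in> N u'" "y \<noteq> v"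
              have "u \<notin> N u'"
              proof
                assume "u \<in> N u'"
                then have "u' \<in> del v u" using N_sym[of u u'] del_N uv by simp
                then show False using H.valid_neq[OF valid c(1)] c same by simp
              qed
              then show "(f(u := Some i)) y \<noteq> Some i"
                using low_nbr[OF v_in(2) c(2) _ uv(2) y(1) i(1)] y same False by auto
            qed
          qed (use total c same uu' i c2 in auto)
          then show False using no by simp
        qed
      qed
    next
      case neq: False
      show ?thesis
      proof (cases "color_index c = 1 \<and> color_index c' = 3")
        case False
        have "valid f" 
        proof (rule valid_lift[OF valid f_v Nv, of c])
          fix d assume "f u' = Some d" "color_index d = 3"
          then have "color_index c \<noteq> 1" using False c by auto
          then show "\<forall>y\<in>N u. y \<noteq> u' \<longrightarrow> f y \<noteq> Some d"
            using low_nbr[OF v_in(1) c(1)] uv \<open>color_index d = 3\<close> by blast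
        qed (use c neq c3 in auto)
        show ?thesis
        proof (cases "color_index c = 1 \<and> color_index c' = 1")
          case True
          have nbr': "\<exists>y\<in>N x. f y = Some i" if "f x = Some d" "color_index d \<noteq> 1" "color_index i = 1" for x d i
            using nbr[OF that] by (auto simp: del_def split: if_splits)
          show ?thesis
            by (rule good_extend_distinct[OF \<open>valid f\<close> f_v total Nv c _ _ neq nbr']) (use True in simp_all)
        next
          case False
          then show ?thesis using \<open>valid f\<close> by (intro finish) auto
        qed
      next
        case True
        then have c1: "color_index c = 1" and c3': "color_index c' = 3" by simp_all
        then have c'1: "color_index c' \<noteq> 1" by simp
        obtain x y where xy: "del v u' = {x, y}" "f x = Some C1a" "f y = Some C1b"
          using ones[OF v_in(2) c(2) c'1] by blast
        let ?f = "f(u' := None)"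
        have "u' \<in> high f" using c c3' by (simp add: high_def)
        moreover have "u' \<notin> high ?f" "high ?f \<subseteq> high f" by (auto simp: high_def)
        ultimately have "high ?f \<subset> high f" by blast
        \<comment> \<open>Erasing \<open>u'\<close> leaves strictly fewer vertices of index 3, so by
          minimality no such \<open>g\<close> exists and any value \<open>d\<close> may be
          claimed.\<close>
        then have no_escape: "g u' = d"
          if "H.valid g" "\<forall>x\<in>V - {v}. g x \<noteq> None" "high g \<subseteq> high ?f" for g d
          using M[OF that(1,2)] that(3) by blast
        have u'_notin: "u' \<notin> del v u'" by (rule H.N_irrefl)
        have low: "low_vertex (V - {v}) (del v) ?f u' x y C1a C1b r s"
          if "color_index r = 2" "color_index s = 2" "r \<noteq> s" for r s
        proof unfold_locales
          show "H.valid ?f" using valid by (rule H.valid_erase)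
          show "del v u' = {x, y}" by (rule xy)
          show "?f x = Some C1a" "?f y = Some C1b" using xy u'_notin by auto
          show "\<exists>y\<in>del v x. ?f y = Some i" if x: "?f x = Some d" "color_index d \<noteq> 1" "color_index i = 1" for x d i
          proof -
            have "f x = Some d" using x(1) by (simp split: if_splits)
            from nbr[OF this x(2,3)] obtain z where "z \<in> del v x" "f z = Some i" by blast
            moreover from this have "z \<noteq> u'" using c c3' x(3) by auto
            ultimately show ?thesis by auto
          qed
        qed (use that total no_escape in auto)
        \<comment> \<open>The new colour of \<open>u'\<close> must avoid the neighbours of
          \<open>u\<close>, which are three steps away through \<open>v\<close>. At most one of them
          has index 3, because \<open>u\<close> is a good root.\<close>
        have "\<exists>i. color_index i = 3 \<and> (\<forall>y\<in>del v u. y \<noteq> u' \<longrightarrow> f y \<noteq> Some i)"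
        proof (rule ccontr)
          assume "\<not> ?thesis"
          then obtain y z where "y \<in> del v u" "f y = Some C3a" "z \<in> del v u" "f z = Some C3b"
            by (metis color_index.simps(5,6))
          moreover from this have "y = z" by (intro one_high) (auto simp: high_def)
          ultimately show False by simp
        qed
        then obtain i where i: "color_index i = 3" "\<forall>y\<in>del v u. y \<noteq> u' \<longrightarrow> f y \<noteq> Some i" by blast
        interpret low: low_vertex "V - {v}" "del v" ?f u' x y C1a C1b C2a C2b by (rule low) simp_all
        have "H.free ?f u' i" by (rule low.free_high[OF low i(1)]) simp_all
        with low.valid_f have "H.valid (?f(u' := Some i))" by (rule H.valid_set)
        then have "H.valid (f(u' := Some i))" by simp
        then have "valid (f(u' := Some i))"
        proof (rule valid_lift[OF _ _ Nv, of _ c])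
          show "\<forall>y\<in>N u. y \<noteq> u' \<longrightarrow> (f(u' := Some i)) y \<noteq> Some d"
            if "(f(u' := Some i)) u' = Some d" for d
            using that i(2) f_v del_N[OF uv(1)] by auto
        qed (use uv f_v c uu' c1 in auto)
        then show ?thesis
          by (rule good_extend_one[OF _ _ _ Nv, of _ c i]) (use f_v uv total c uu' c1 i(1) in \<open>auto simp: high_def\<close>)
      qed
    qed
  qed
qed

end

text \<open>A neighbour \<open>u\<close> of the removed vertex \<open>v\<close> loses an edge, so
  its degree drops to at most 2 and it can be the next root. If \<open>v\<close> is isolated, the
  sparsity assumption supplies a root.\<close>

lemma ex_good:
  assumes "subcubic_nbhd V N" and "\<And>U. U \<subseteq> V \<Longrightarrow> U \<noteq> {} \<Longrightarrow> \<exists>v\<in>U. card (N v \<inter> U) \<le> 2"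
    and "v \<in> V" "card (N v) \<le> 2"
  shows "\<exists>g. subcubic_nbhd.good V N g v"
  using assms
proof (induction "card V" arbitrary: V N v)
  case 0
  then show ?case using subcubic_nbhd.finite_V by fastforce
next
  case (Suc n)
  interpret subcubic_nbhd V N by fact
  let ?V = "V - {v}" and ?N = "del v"
  have H: "subcubic_nbhd ?V ?N" by (rule nbhd_del)
  have card: "n = card ?V" using Suc.hyps(2) Suc.prems(3) finite_V by simp
  have sparse: "\<exists>x\<in>U. card (?N x \<inter> U) \<le> 2" if U: "U \<subseteq> ?V" "U \<noteq> {}" for U
  proof -
    have "?N x \<inter> U = N x \<inter> U" if "x \<in> U" for x using that U by (auto simp: del_def)
    then show ?thesis using Suc.prems(2)[of U] U by auto
  qed
  have IH: "\<exists>g. subcubic_nbhd.good ?V ?N g x" if "x \<in> ?V" "card (?N x) \<le> 2" for x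
    using card H sparse that by (rule Suc.hyps(1))
  show ?case
  proof (cases "N v = {}")
    case True
    then have "v \<notin> N x" for x using N_sym by blast
    then have eq: "?N = N" using True by (intro ext) (simp add: del_def)
    have "\<exists>g. valid g \<and> (\<forall>x\<in>?V. g x \<noteq> None)"
    proof (cases "?V = {}")
      case True
      have "valid (\<lambda>_. None)" by (simp add: valid_def)
      then show ?thesis using True by blast
    next
      case False
      obtain x where x: "x \<in> ?V" "card (N x \<inter> ?V) \<le> 2" using Suc.prems(2)[of ?V] False by blast
      have "N x \<subseteq> ?V" using N_V \<open>v \<notin> N x\<close> by blast
      then have "N x \<inter> ?V = N x" by blast
      then obtain g where "subcubic_nbhd.good ?V ?N g x" using IH[of x] x unfolding eq by auto
      moreover have "subcubic_nbhd ?V N" using H unfolding eq .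
      note subcubic_nbhd.good_def[OF this]
      ultimately have "valid g \<and> (\<forall>x\<in>?V. g x \<noteq> None)" by (simp add: eq)
      then show ?thesis by blast
    qed
    then obtain g where g: "valid g" "\<forall>x\<in>?V. g x \<noteq> None" by blast
    have "free g v C1a" by (simp add: free1 True)
    with g(1) have "valid (g(v := Some C1a))" by (rule valid_set)
    then have "good (g(v := Some C1a)) v" using g(2) True by (auto simp: good_def high_def)
    then show ?thesis by blast
  next
    case False
    then obtain u where u: "u \<in> N v" by blast
    have "\<exists>u'. N v = {u, u'}"
    proof (cases "N v = {u}")
      case False
      then obtain u' where u': "u' \<in> N v" "u' \<noteq> u" using u by blast
      then have "card {u, u'} = 2" by simp
      then have "{u, u'} = N v" using u u' Suc.prems(4) by (intro card_seteq finite_N) auto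
      then show ?thesis by blast
    qed auto
    then obtain u' where Nv: "N v = {u, u'}" by blast
    have uV: "u \<in> ?V" using u N_V N_irrefl[of v] by auto
    have "v \<in> N u" using u by (rule N_sym)
    then have "card (?N u) \<le> 2" using card_N[of u] uV finite_N by (simp add: del_def)
    then obtain g where "subcubic_nbhd.good ?V ?N g u" using IH[OF uV] by blast
    then show ?thesis by (rule extend_good[OF u Nv])
  qed
qed

section \<open>Distances and subdivision\<close>

lemma (in pair_wf_digraph) wf_with_proj: "wf_digraph (with_proj G)"
  by unfold_locales

context pair_graph
begin

definition nbhd :: "'a \<Rightarrow> 'a set" where
  "nbhd x = {y. (x, y) \<in> parcs G}"

lemma card_nbhd: "out_degree (with_proj G) x = card (nbhd x)"
proof -
  have "out_arcs (with_proj G) x = Pair x ` nbhd x"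
    by (auto simp: out_arcs_def nbhd_def)
  then show ?thesis by (simp add: out_degree_def card_image inj_on_def)
qed

lemma subcubic_nbhd_nbhd:
  assumes "subcubic G"
  shows "subcubic_nbhd (pverts G) nbhd"
proof
  show "finite (pverts G)" by (rule pair_finite_verts)
  show "y \<in> pverts G" if "y \<in> nbhd x" for x y using that by (auto simp: nbhd_def dest: in_arcsD2)
  show "x \<in> nbhd y" if "y \<in> nbhd x" for x y using that by (auto simp: nbhd_def intro: arcs_symmetric)
  show "x \<notin> nbhd x" for x using pair_no_loops[of "(x, x)"] by (auto simp: nbhd_def)
  show "card (nbhd x) \<le> 3" for x
  proof (cases "x \<in> pverts G")
    case True
    then show ?thesis using assms by (simp add: subcubic_def card_nbhd)
  next
    case False
    then have "nbhd x = {}" by (auto simp: nbhd_def dest: in_arcsD1)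
    then show ?thesis by simp
  qed
qed

text \<open>\<open>?H\<close> is the subgraph induced by \<open>U\<close>, whose neighbourhoods are
  the sets \<open>nbhd x \<inter> U\<close>.\<close>

lemma degenerate_nbhd:
  assumes "degenerate k G" "U \<subseteq> pverts G" "U \<noteq> {}"
  shows "\<exists>x\<in>U. card (nbhd x \<inter> U) \<le> k"
proof -
  let ?H = "\<lparr>pverts = U, parcs = parcs G \<inter> U \<times> U\<rparr>"
  have H: "pair_graph ?H"
  proof
    show "finite (pverts ?H)" using assms(2) pair_finite_verts by (simp add: finite_subset)
    show "symmetric (with_proj ?H)"
      unfolding symmetric_def by (auto intro!: symI intro: arcs_symmetric)
  qed (use pair_no_loops in auto)
  interpret H: pair_graph ?H by (rule H)
  have "subgraph (with_proj ?H) (with_proj G)"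
    unfolding subgraph_def using assms(2) wf_with_proj H.wf_with_proj by (simp add: compatible_def Int_lower1)
  then obtain x where "x \<in> U" "out_degree (with_proj ?H) x \<le> k"
    using assms(1,3) H unfolding degenerate_def by (metis pair_pre_digraph.select_convs(1))
  moreover from this have "H.nbhd x = nbhd x \<inter> U"
    by (auto simp: H.nbhd_def nbhd_def)
  ultimately show ?thesis using H.card_nbhd by metis
qed

end

lemma graph_dist_ge:
  assumes "pair_wf_digraph G" "\<And>p. pre_digraph.awalk (with_proj G) u p v \<Longrightarrow> n \<le> length p"
  shows "ereal (real n) \<le> graph_dist G u v"
proof -
  interpret pair_wf_digraph G by fact
  have cost: "awalk_cost (\<lambda>_. 1) p = real (length p)" for p :: "('a \<times> 'a) list"
    by (simp add: awalk_cost_def sum_list_triv)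
  show ?thesis
    unfolding graph_dist_def \<mu>_def cost using assms(2) by (auto intro!: INF_greatest)
qed

lemma (in pair_graph) short_awalk:
  assumes "awalk x p y" "x \<noteq> y" "length p \<le> 3"
  shows "y \<in> nbhd x \<or> 2 \<le> length p \<and> (\<exists>a\<in>nbhd x. y \<in> nbhd a) \<or>
    3 \<le> length p \<and> (\<exists>a\<in>nbhd x. \<exists>b\<in>nbhd a. y \<in> nbhd b)"
proof (cases p)
  case Nil
  then show ?thesis using assms by (simp add: awalk_Nil_iff)
next
  case p1: (Cons e1 p1)
  show ?thesis
  proof (cases p1)
    case Nil
    then show ?thesis using assms p1 by (cases e1) (auto simp: awalk_Cons_iff awalk_Nil_iff nbhd_def)
  next
    case p2: (Cons e2 p2)
    show ?thesis
    proof (cases p2)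
      case Nil
      then show ?thesis using assms p1 p2
        by (cases e1; cases e2) (auto simp: awalk_Cons_iff awalk_Nil_iff nbhd_def)
    next
      case p3: (Cons e3 p3)
      then have "p3 = []" using assms p1 p2 by simp
      then show ?thesis using assms p1 p2 p3
        by (cases e1; cases e2; cases e3) (auto simp: awalk_Cons_iff awalk_Nil_iff nbhd_def)
    qed
  qed
qed

text \<open>Arcs are consumed in pairs, as every second vertex of the walk is a subdividing one. A
  pair that turns back contributes nothing to \<open>q\<close>, hence only an inequality.\<close>

lemma awalk_subdivide_all:
  assumes G: "pair_graph G"
    and p: "pre_digraph.awalk (with_proj (subdivide_all G)) (Inl x) p (Inl y)"
  shows "\<exists>q. pre_digraph.awalk (with_proj G) x q y \<and> 2 * length q \<le> length p"
  using p
proof (induction "length p" arbitrary: x p rule: less_induct)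
  case less
  interpret G: pair_graph G by (rule G)
  interpret D: pair_graph "subdivide_all G" by (rule pair_graph_subdivide_all[OF G])
  show ?case
  proof (cases p)
    case Nil
    then have *: "x = y \<and> Inl x \<in> pverts (subdivide_all G)" using less.prems by (auto simp: D.awalk_Nil_iff)
    then have "x = y" "x \<in> pverts G" by (auto simp: subdivide_all_def)
    then show ?thesis using Nil by (intro exI[of _ "[]"]) (simp add: G.awalk_Nil_iff)
  next
    case (Cons e1 p1)
    then have e: "e1 \<in> parcs (subdivide_all G)" "fst e1 = Inl x" "D.awalk (snd e1) p1 (Inl y)"
      using less.prems by (simp_all add: D.awalk_Cons_iff)
    from e(1,2) obtain b where e1: "e1 = (Inl x, Inr {x, b})" "(x, b) \<in> parcs G"
      by (auto simp: subdivide_all_def)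
    then have w1: "D.awalk (Inr {x, b}) p1 (Inl y)" using e(3) by simp
    obtain e2 p2 where p1: "p1 = e2 # p2" using w1 by (cases p1) (auto simp: D.awalk_Nil_iff)
    have "e2 \<in> parcs (subdivide_all G)" "fst e2 = Inr {x, b}" and w2': "D.awalk (snd e2) p2 (Inl y)"
      using w1 p1 by (simp_all add: D.awalk_Cons_iff)
    then have "snd e2 = Inl x \<or> snd e2 = Inl b"
      by (auto simp: subdivide_all_def doubleton_eq_iff)
    then obtain z where z: "z = x \<or> z = b" and w2: "D.awalk (Inl z) p2 (Inl y)"
      using w2' by metis
    obtain q where q: "G.awalk z q y" "2 * length q \<le> length p2"
      using less.hyps[OF _ w2] Cons p1 by auto
    show ?thesis
    proof (cases "z = x")
      case True
      then show ?thesis using q Cons p1 by auto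
    next
      case False
      then have "G.awalk x ((x, b) # q) y" using q z e1(2) by (simp add: G.awalk_Cons_iff)
      then show ?thesis using q(2) Cons p1 by (intro exI[of _ "(x, b) # q"]) simp
    qed
  qed
qed

text \<open>
  Class 1 consists of the subdividing vertices, and distances between original vertices double.
\<close>

fun class_of_color :: "color \<Rightarrow> nat" where
  "class_of_color C1a = 2"
| "class_of_color C1b = 3"
| "class_of_color C2a = 4"
| "class_of_color C2b = 5"
| "class_of_color C3a = 6"
| "class_of_color C3b = 7"

text \<open>A colour of index \<open>i\<close> keeps distance \<open>i + 1\<close> in
  \<open>G\<close>, hence \<open>2 * (i + 1)\<close> after subdivision, which suffices for classes
  up to \<open>2 * i + 1\<close>.\<close>

lemma class_of_color_bounds: "class_of_color c \<in> {2..7}" "class_of_color c + 1 \<le> 2 * (color_index c + 1)"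
  by (cases c; simp)+

lemma class_of_color_inj: "class_of_color c = class_of_color d \<Longrightarrow> c = d"
  by (cases c; cases d) simp_all

lemma packing_subdivide_all:
  assumes G: "pair_graph G"
    and walk: "\<And>x y p. x \<in> pverts G \<Longrightarrow> y \<in> pverts G \<Longrightarrow> x \<noteq> y \<Longrightarrow> c x = c y \<Longrightarrow>
      pre_digraph.awalk (with_proj G) x p y \<Longrightarrow> color_index (c x) + 1 \<le> length p"
  shows "\<exists>V. packing_coloring (subdivide_all G) 7 V"
proof -
  define S where "S = {Inr {x, y} :: 'a + 'a set | x y. (x, y) \<in> parcs G}"
  define V where "V i = (if i = 1 then S else Inl ` {x \<in> pverts G. class_of_color (c x) = i})" for i :: nat
  interpret D: pair_graph "subdivide_all G" by (rule pair_graph_subdivide_all[OF G])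
  have "(\<Union>i\<in>{1..7}. V i) = pverts (subdivide_all G)"
  proof
    show "(\<Union>i\<in>{1..7}. V i) \<subseteq> pverts (subdivide_all G)"
      by (auto simp: V_def S_def subdivide_all_def split: if_splits)
    show "pverts (subdivide_all G) \<subseteq> (\<Union>i\<in>{1..7}. V i)"
    proof
      fix z assume "z \<in> pverts (subdivide_all G)"
      then consider x where "x \<in> pverts G" "z = Inl x" | "z \<in> S"
        by (auto simp: subdivide_all_def S_def)
      then show "z \<in> (\<Union>i\<in>{1..7}. V i)"
      proof cases
        case 1
        then have "z \<in> V (class_of_color (c x))" using class_of_color_bounds(1)[of "c x"] by (auto simp: V_def)
        then show ?thesis using class_of_color_bounds(1)[of "c x"] by (intro UN_I[of "class_of_color (c x)"]) auto
      next
        case 2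
        then have "z \<in> V 1" by (simp add: V_def)
        then show ?thesis by (intro UN_I[of 1]) auto
      qed
    qed
  qed
  moreover have "V i \<inter> V j = {}" if "i \<noteq> j" for i j
    using that by (auto simp: V_def S_def split: if_splits)
  moreover have "ereal (real (i + 1)) \<le> graph_dist (subdivide_all G) u v"
    if uv: "u \<in> V i" "v \<in> V i" "u \<noteq> v" for i u v
  proof (rule graph_dist_ge)
    show "pair_wf_digraph (subdivide_all G)" by (rule D.pair_wf_digraph_axioms)
    fix p assume p: "D.awalk u p v"
    have p0: "p \<noteq> []" using p uv(3) by (auto simp: D.awalk_Nil_iff)
    show "i + 1 \<le> length p"
    proof (cases "i = 1")
      case True
      have "p \<noteq> [e]" for e
      proof
        assume "p = [e]"
        then have "(u, v) \<in> parcs (subdivide_all G)" using p by (cases e) (simp add: D.awalk_Cons_iff D.awalk_Nil_iff)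
        then show False using uv True by (auto simp: V_def S_def subdivide_all_def)
      qed
      then have "2 \<le> length p" using p0 by (cases p; cases "tl p") auto
      then show ?thesis using True by simp
    next
      case False
      then obtain x y where xy: "u = Inl x" "v = Inl y" "x \<in> pverts G" "y \<in> pverts G"
        "class_of_color (c x) = i" "class_of_color (c y) = i"
        using uv by (auto simp: V_def)
      then have "c x = c y" by (intro class_of_color_inj) simp
      moreover obtain q where "pre_digraph.awalk (with_proj G) x q y" "2 * length q \<le> length p"
        using awalk_subdivide_all[OF G] p xy by blast
      ultimately have "2 * (color_index (c x) + 1) \<le> length p"
        using walk[of x y q] xy uv(3) by auto
      then show ?thesis using class_of_color_bounds(2)[of "c x"] xy by simp
    qed
  qed
  ultimately have "packing_coloring (subdivide_all G) 7 V" unfolding packing_coloring_def by blast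
  then show ?thesis by blast
qed

lemma (in pair_graph) good_awalk:
  assumes "subcubic G" and g: "subcubic_nbhd.good (pverts G) nbhd g r"
    and x: "x \<in> pverts G" and y: "y \<in> pverts G" and neq: "x \<noteq> y" and same: "the (g x) = the (g y)"
    and p: "awalk x p y"
  shows "color_index (the (g x)) + 1 \<le> length p"
proof (rule ccontr)
  interpret N: subcubic_nbhd "pverts G" nbhd by (rule subcubic_nbhd_nbhd) fact
  assume "\<not> ?thesis"
  then have short: "length p \<le> color_index (the (g x))" by simp
  then have "length p \<le> 3" using color_index_cases[of "the (g x)"] by auto
  obtain c where c: "g x = Some c" "g y = Some c" using g x y same unfolding N.good_def by force
  then have "N.free g x c" using g unfolding N.good_def N.valid_def by blast
  note free = this[unfolded N.free_def]
  have le: "length p \<le> color_index c" using short c by simp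
  from short_awalk[OF p neq \<open>length p \<le> 3\<close>] show False
  proof (elim disjE conjE bexE)
    assume "y \<in> nbhd x"
    then show False using free c(2) by blast
  next
    fix a assume "2 \<le> length p" and a: "a \<in> nbhd x" "y \<in> nbhd a"
    then have "2 \<le> color_index c" using le by simp
    with free[THEN bspec, OF a(1)] a(2) neq c(2) show False by auto
  next
    fix a b assume p3: "3 \<le> length p" and ab: "a \<in> nbhd x" "b \<in> nbhd a" "y \<in> nbhd b"
    have idx: "2 \<le> color_index c" "3 \<le> color_index c" using p3 le by simp_all
    show False
    proof (cases "b = x")
      \<comment> \<open>A walk that returns to \<open>x\<close> after two steps ends at a neighbour
        of \<open>x\<close>, where the first clause of \<open>free\<close> applies.\<close>
      case True
      then show False using free ab(3) c(2) by blast
    next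
      case False
      with free[THEN bspec, OF ab(1)] idx ab(2) have "\<forall>t\<in>nbhd b. t \<noteq> x \<longrightarrow> g t \<noteq> Some c" by simp
      then show False using ab(3) neq c(2) by auto
    qed
  qed
qed

theorem theorem5:
  fixes G :: "'a pair_pre_digraph"
  assumes "pair_graph G"
    and "subcubic G"
    and "degenerate 2 G"
  shows "(\<exists>c. feasible_coloring G c) \<and> (\<exists>V. packing_coloring (subdivide_all G) 7 V)"
proof -
  interpret pair_graph G by fact
  have N: "subcubic_nbhd (pverts G) nbhd" using assms(2) by (rule subcubic_nbhd_nbhd)
  \<comment> \<open>The bound on walks serves both halves: it gives the distances in
    \<open>G\<close> and, by doubling, those in the subdivision.\<close>
  have "\<exists>c. \<forall>x\<in>pverts G. \<forall>y\<in>pverts G. \<forall>p. x \<noteq> y \<longrightarrow> c x = c y \<longrightarrow> awalk x p y \<longrightarrow>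
    color_index (c x) + 1 \<le> length p"
  proof (cases "pverts G = {}")
    case False
    then obtain r where r: "r \<in> pverts G" "card (nbhd r \<inter> pverts G) \<le> 2"
      using degenerate_nbhd[OF assms(3)] by blast
    have "nbhd r \<inter> pverts G = nbhd r" using subcubic_nbhd.N_V[OF N] by blast
    then obtain g where "subcubic_nbhd.good (pverts G) nbhd g r"
      using ex_good[OF N degenerate_nbhd[OF assms(3)] r(1)] r(2) by auto
    then show ?thesis using good_awalk[OF assms(2)] by (intro exI[of _ "\<lambda>x. the (g x)"]) blast
  qed simp
  then obtain c where c: "color_index (c x) + 1 \<le> length p"
    if "x \<in> pverts G" "y \<in> pverts G" "x \<noteq> y" "c x = c y" "awalk x p y" for x y p
    by metis
  have "feasible_coloring G c"
    unfolding feasible_coloring_def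
  proof (intro ballI impI)
    fix x y assume xy: "x \<in> pverts G" "y \<in> pverts G" "x \<noteq> y \<and> c x = c y"
    show "ereal (real (color_index (c x) + 1)) \<le> graph_dist G x y"
      by (rule graph_dist_ge[OF pair_wf_digraph_axioms]) (use c xy in blast)
  qed
  moreover have "\<exists>V. packing_coloring (subdivide_all G) 7 V"
    using assms(1) c by (rule packing_subdivide_all)
  ultimately show ?thesis by blast
qed

end
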